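(* As $x \to \infty$ through composite odd integers, $$\lambda_x \sim \log x,$$ that is, $\lim_{x\to\infty} \dfrac{\lambda_x}{\log x} = 1$.
   Context: Throughout, $x$ denotes a composite odd positive integer (so $x \ge 9$), and $\log$ is the natural logarithm. Let $p_n$ be the largest prime not exceeding $x$ (so $p_n < x < p_{n+1}$, where $p_i$ denotes the $i$-th prime). For each pair of consecutive primes $(p_i, p_{i+1})$ with $p_{i+1} - p_i > 2$ and $p_i < x$, consider the sequence of composite integers strictly between $p_i$ and $p_{i+1}$ that do not exceed $x$; thus the sequence is $(p_i+1, \dots, p_{i+1}-1)$ when $p_i < p_n$, and the last one is truncated at $x$, being $(p_n+1, \dots, x)$. Let $\mathscr{S}_1 = \{(8,9,10), (14,15,16), (20,21,22), \dots, (p_n+1,\dots,x)\}$ be the set of all these sequences. Then $\lambda_x$ is the average number of composite integers per sequence in $\mathscr{S}_1$: $$\lambda_x = \frac{\left|\bigcup_{s \in \mathscr{S}_1} s\right|}{|\mathscr{S}_1|},$$ where the union is the set of all integers occurring in the sequences. (For example, for $x=25$, $\lambda_x = 11/4$.) *)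

theory Defs
  imports Complex_Main "HOL-Computational_Algebra.Primes"
begin

definition composite :: "nat \<Rightarrow> bool" where
  "composite m \<longleftrightarrow> 1 < m \<and> \<not> prime m"

definition consecutive_primes :: "nat \<Rightarrow> nat \<Rightarrow> bool" where
  "consecutive_primes p q \<longleftrightarrow> prime p \<and> prime q \<and> p < q \<and> (\<forall>r. p < r \<and> r < q \<longrightarrow> \<not> prime r)"

text \<open>The bound \<open>m \<le> x\<close> only matters for the last pair of primes, whose sequence is truncated at \<open>x\<close>.\<close>

definition composite_seq :: "nat \<Rightarrow> nat \<Rightarrow> nat \<Rightarrow> nat list" where
  "composite_seq x p q = filter (\<lambda>m. composite m \<and> m \<le> x) [p + 1..<q]"

definition composite_seqs :: "nat \<Rightarrow> nat list set" where
  "composite_seqs x = {composite_seq x p q | p q. consecutive_primes p q \<and> q - p > 2 \<and> p < x}"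

definition avg_composites :: "nat \<Rightarrow> real" where
  "avg_composites x =
     real (card (\<Union>s\<in>composite_seqs x. set s)) / real (card (composite_seqs x))"

end

theory Submission
  imports Defs
    "HOL-Complex_Analysis.Complex_Analysis"
    "HOL-Number_Theory.Prime_Powers"
    "HOL-Number_Theory.Cong"
    "HOL-Real_Asymp.Real_Asymp"
begin

text \<open>
  A sequence in \<open>composite_seqs x\<close> is determined by the prime \<open>p < x\<close> below it, and a prime
  \<open>p < x\<close> fails to produce one exactly when its gap is at most \<open>2\<close>, so when \<open>p = 2\<close> or \<open>p\<close> is
  the smaller member of a pair of twin primes. The composite numbers that no sequence
  contains are those caught between twin primes. If \<open>\<pi>(x)\<close> and \<open>T(x)\<close> count the primes and the
  twin pairs up to \<open>x\<close>, the average is therefore squeezed between \<open>(x - \<pi>(x) - T(x) - 2) / \<pi>(x)\<close>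
  and \<open>x / (\<pi>(x) - T(x) - 2)\<close>. Two facts finish the proof: \<open>\<pi>(x)\<close> is asymptotic to \<open>x / ln x\<close>
  (\<open>prime_number_theorem\<close>), and \<open>T(x) = o(x / ln x)\<close> (\<open>twin_count_negligible\<close>).

  The prime number theorem is proved by Newman's contour argument. Write \<open>\<psi>\<close> for the summatory
  function of the von Mangoldt function \<open>\<Lambda>\<close>. It suffices that the series of
  \<open>(\<psi>(n) - n) / (n (n + 1))\<close> converges, because \<open>\<psi>\<close> is monotone, so one value far from its
  expected size spoils a whole block of terms (\<open>psi_eventually_le\<close>, \<open>psi_eventually_ge\<close>). This
  series is the value at \<open>s = 1\<close> of a family of integrals of \<open>\<psi>(u) - \<lfloor>u\<rfloor>\<close> against \<open>u\<close> to the power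
  \<open>-s - 1\<close>; for \<open>Re s > 1\<close> they sum to \<open>(- \<zeta>'/\<zeta> - \<zeta>)(s) / s\<close>. The poles at \<open>1\<close> cancel, and \<open>\<zeta>\<close> has no
  zero with \<open>Re s = 1\<close> (\<open>zeta_reg_nonzero\<close>), so the right-hand side is holomorphic on a
  neighbourhood of the closed half-plane. Chebyshev's bound \<open>\<psi>(n) = O(n)\<close> and
  \<open>newman_tauberian\<close> then give convergence at the boundary point.

  The twin primes are bounded by Brun's pure sieve: inclusion-exclusion over sets of odd
  primes up to \<open>z\<close>, cut off at sets of \<open>m\<close> elements (\<open>twin_count_le_brun\<close>). The resulting bound is
  of order \<open>x / (ln z)\<^sup>2\<close> up to small errors, and any \<open>z\<close> with \<open>ln z\<close> a power of \<open>ln x\<close>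
  with exponent slightly above \<open>1/2\<close> makes this \<open>o(x / ln x)\<close>.
\<close>

section \<open>Chebyshev bounds from factorials\<close>

definition psi :: "nat \<Rightarrow> real" where
  "psi n = (\<Sum>d=1..n. mangoldt d)"

lemma psi_0 [simp]: "psi 0 = 0" by (simp add: psi_def)

lemma psi_Suc: "psi (Suc n) = psi n + mangoldt (Suc n)" by (simp add: psi_def)

lemma psi_mono: "m \<le> n \<Longrightarrow> psi m \<le> psi n"
  unfolding psi_def by (intro sum_mono2) (auto intro: mangoldt_nonneg)

lemma psi_nonneg: "psi n \<ge> 0"
  unfolding psi_def by (intro sum_nonneg mangoldt_nonneg)

text \<open>
  Legendre's formula. Passing from \<open>n\<close> to \<open>n + 1\<close> raises \<open>n div d\<close> exactly for the divisors \<open>d\<close>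
  of \<open>n + 1\<close>, and \<open>\<Lambda>\<close> sums to \<open>ln (n + 1)\<close> over these. The free upper limit \<open>N\<close> lets
  several such identities be combined term by term.
\<close>

lemma ln_fact_eq_sum_mangoldt:
  assumes "n \<le> N"
  shows "ln (fact n) = (\<Sum>d=1..N. mangoldt d * real (n div d))"
  using assms
proof (induction n)
  case (Suc n)
  have "(\<Sum>d=1..N. mangoldt d * real (Suc n div d)) =
      (\<Sum>d=1..N. mangoldt d * real (n div d) + (if d dvd Suc n then mangoldt d else 0))"
    by (intro sum.cong) (auto simp: div_Suc algebra_simps dvd_eq_mod_eq_0)
  also have "\<dots> = ln (fact n) + (\<Sum>d=1..N. if d dvd Suc n then mangoldt d else 0)"
    using Suc by (simp add: sum.distrib)
  also have "(\<Sum>d=1..N. if d dvd Suc n then mangoldt d else 0) = (\<Sum>d | d dvd Suc n. mangoldt d :: real)"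
  proof -
    have "{d. d dvd Suc n} = {d\<in>{1..N}. d dvd Suc n}"
    proof (intro set_eqI iffI)
      fix d assume "d \<in> {d. d dvd Suc n}"
      then have "d dvd Suc n" by simp
      with dvd_imp_le[OF this] dvd_pos_nat[OF _ this] Suc.prems show "d \<in> {d \<in> {1..N}. d dvd Suc n}" by simp
    qed simp
    then show ?thesis by (simp only: sum.inter_filter finite_atLeastAtMost)
  qed
  also have "\<dots> = ln (real (Suc n))" using mangoldt_sum[of "Suc n", where ?'a = real] by simp
  finally show ?case by (simp add: ln_mult)
qed simp

text \<open>
  Chebyshev's trick: in the logarithm of the central binomial coefficient, \<open>\<Lambda>(d)\<close> has the weight
  \<open>2n div d - 2 (n div d)\<close>, which is never negative and equals \<open>1\<close> for \<open>n < d \<le> 2n\<close>.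
\<close>

lemma psi_double: "psi (2 * n) - psi n \<le> 2 * real n * ln 2"
proof -
  have "psi (2 * n) = psi n + (\<Sum>d=n+1..2*n. mangoldt d)"
    unfolding psi_def using sum.ub_add_nat[of 1 n mangoldt n] by (simp add: mult_2)
  then have "psi (2 * n) - psi n = (\<Sum>d=n+1..2*n. mangoldt d)" by simp
  also have "\<dots> \<le> (\<Sum>d=n+1..2*n. mangoldt d * (real (2 * n div d) - 2 * real (n div d)))"
  proof (intro sum_mono)
    fix d assume d: "d \<in> {n+1..2*n}"
    then have "2 * n div d = 1" by (intro div_nat_eqI) auto
    then show "mangoldt d \<le> mangoldt d * (real (2 * n div d) - 2 * real (n div d))" using d by simp
  qed
  also have "\<dots> \<le> (\<Sum>d=1..2*n. mangoldt d * (real (2 * n div d) - 2 * real (n div d)))"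
  proof (intro sum_mono2 mult_nonneg_nonneg mangoldt_nonneg)
    fix d
    have "2 * (n div d) \<le> 2 * n div d"
      using less_eq_div_iff_mult_less_eq[of d "2 * (n div d)" "2 * n"]
      by (cases "d = 0") auto
    then show "0 \<le> real (2 * n div d) - 2 * real (n div d)" by linarith
  qed auto
  also have "\<dots> = ln (fact (2 * n)) - 2 * ln (fact n)"
    using ln_fact_eq_sum_mangoldt[of "2*n" "2*n"] ln_fact_eq_sum_mangoldt[of "n" "2*n"]
    by (simp add: algebra_simps sum_subtractf sum_distrib_left)
  also have "\<dots> = ln (real ((2 * n) choose n))"
  proof -
    have "real ((2 * n) choose n) = fact (2 * n) / (fact n * fact n)"
      using binomial_fact[of n "2 * n", where ?'a = real] by (simp add: mult_2)
    then show ?thesis by (simp only: ln_div ln_mult fact_nonzero mult_eq_0_iff) (simp add: ln_div ln_mult)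
  qed
  also have "\<dots> \<le> ln (2 ^ (2 * n))"
  proof -
    have "(2 * n choose n) \<le> 2 ^ (2 * n)" by (rule binomial_le_pow2)
    then have "real (2 * n choose n) \<le> 2 ^ (2 * n)" using of_nat_mono[of "2 * n choose n" "2 ^ (2 * n)", where ?'a = real] by simp
    then show ?thesis by (subst ln_le_cancel_iff) auto
  qed
  also have "\<dots> = 2 * real n * ln 2" by (simp add: ln_realpow)
  finally show ?thesis .
qed

text \<open>
  Doubling costs at most \<open>2 m ln 2 \<le> 2 m\<close> by \<open>psi_double\<close>, so the constant \<open>4\<close> leaves room for
  the extra term \<open>ln n\<close> that appears for odd \<open>n\<close>.
\<close>

lemma psi_le: "psi n \<le> 4 * real n"
proof (induction n rule: less_induct)
  case (less n)
  have l2: "ln 2 \<le> (1::real)" using ln_le_minus_one[of "2::real"] by simp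
  consider "n = 0" | m where "n = 2 * m" "m > 0" | m where "n = 2 * m + 1"
    by (cases "even n") (fastforce elim!: evenE, fastforce elim!: oddE)
  then show ?case
  proof cases
    case (2 m)
    have "psi n \<le> psi m + 2 * real m * ln 2" using psi_double[of m] 2 by simp
    also have "\<dots> \<le> 4 * real m + 2 * real m * 1" using 2 l2 less[of m] by (intro add_mono mult_left_mono) auto
    finally show ?thesis using 2 by simp
  next
    case (3 m)
    have "psi n = psi (2 * m) + mangoldt n" using psi_Suc[of "2 * m"] 3 by simp
    also have "\<dots> \<le> (psi m + 2 * real m * ln 2) + ln (real n)"
      using psi_double[of m] 3 by (intro add_mono mangoldt_le) auto
    also have "\<dots> \<le> (4 * real m + 2 * real m * 1) + (real n - 1)"
      using 3 l2 less[of m] by (intro add_mono mult_left_mono ln_le_minus_one) auto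
    finally show ?thesis using 3 by simp
  qed simp
qed

lemma ln_fact_le: "ln (fact n) \<le> real n * ln (real n)"
proof (cases "n = 0")
  case False
  have "ln (fact n :: real) \<le> ln (real n ^ n)"
    using fact_le_power[of n, where ?'a=real] False by (subst ln_le_cancel_iff) auto
  then show ?thesis using False by (simp add: ln_realpow)
qed simp

text \<open>
  One half of Mertens' first theorem. Replacing \<open>n / d\<close> by \<open>n div d\<close> turns the sum into Legendre's
  formula at the cost of \<open>\<psi>(n)\<close>. It controls the reciprocal sum of primes in the sieve.
\<close>

lemma sum_mangoldt_over_le:
  assumes "n > 0"
  shows "(\<Sum>d=1..n. mangoldt d / real d) \<le> ln (real n) + 4"
proof -
  have "real n * (\<Sum>d=1..n. mangoldt d / real d) = (\<Sum>d=1..n. mangoldt d * (real n / real d))"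
    by (simp add: sum_distrib_left mult_ac)
  also have "\<dots> \<le> (\<Sum>d=1..n. mangoldt d * (real (n div d) + 1))"
  proof (intro sum_mono mult_left_mono mangoldt_nonneg)
    fix d show "real n / real d \<le> real (n div d) + 1"
      using real_of_int_div3[of "int n" "int d"] by (simp flip: zdiv_int)
  qed
  also have "\<dots> = ln (fact n) + psi n"
    by (simp add: algebra_simps sum.distrib psi_def ln_fact_eq_sum_mangoldt[of n n])
  also have "\<dots> \<le> real n * (ln (real n) + 4)"
    using ln_fact_le[of n] psi_le[of n] by (simp add: algebra_simps)
  finally show ?thesis using assms by simp
qed

section \<open>Dirichlet series with slowly growing coefficients\<close>

text \<open>
  Weierstrass's theorem in the form used for all series below: local domination by a summable
  sequence yields holomorphy, absolute convergence and term-by-term differentiation together.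
\<close>

lemma holomorphic_dominated_series:
  fixes f :: "nat \<Rightarrow> complex \<Rightarrow> complex"
  assumes S: "open S" and f: "\<And>n. f n holomorphic_on S"
    and dom: "\<And>x. x \<in> S \<Longrightarrow> \<exists>d h. 0 < d \<and> summable h \<and> (\<forall>n. \<forall>y\<in>ball x d \<inter> S. norm (f n y) \<le> h n)"
  shows "(\<lambda>s. \<Sum>n. f n s) holomorphic_on S"
    and "s \<in> S \<Longrightarrow> summable (\<lambda>n. norm (f n s))"
    and "s \<in> S \<Longrightarrow> (\<lambda>n. deriv (f n) s) sums deriv (\<lambda>s. \<Sum>n. f n s) s"
proof -
  have "\<exists>g g'. \<forall>x \<in> S. ((\<lambda>n. f n x) sums g x) \<and> ((\<lambda>n. deriv (f n) x) sums g' x) \<and> (g has_field_derivative g' x) (at x)"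
  proof (rule series_and_derivative_comparison_local[OF S])
    show "\<And>n x. x \<in> S \<Longrightarrow> (f n has_field_derivative deriv (f n) x) (at x)"
      using f S by (rule holomorphic_derivI)
    fix x assume "x \<in> S"
    from dom[OF this] obtain d h where "0 < d" "summable h" "\<forall>n. \<forall>y\<in>ball x d \<inter> S. norm (f n y) \<le> h n" by blast
    then show "\<exists>d h. 0 < d \<and> summable h \<and> (\<forall>\<^sub>F n in sequentially. \<forall>y\<in>ball x d \<inter> S. norm (f n y) \<le> h n)"
      by (intro exI[of _ d] exI[of _ h]) auto
  qed
  then obtain g g' where g: "\<And>x. x \<in> S \<Longrightarrow> (\<lambda>n. f n x) sums g x" "\<And>x. x \<in> S \<Longrightarrow> (\<lambda>n. deriv (f n) x) sums g' x"
      "\<And>x. x \<in> S \<Longrightarrow> (g has_field_derivative g' x) (at x)" by blast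
  have d: "((\<lambda>s. \<Sum>n. f n s) has_field_derivative g' x) (at x)" if "x \<in> S" for x
  proof (rule has_field_derivative_transform_within_open[OF g(3)[OF that] S that])
    show "\<And>x. x \<in> S \<Longrightarrow> g x = (\<Sum>n. f n x)" using g(1) by (simp add: sums_unique)
  qed
  show "(\<lambda>s. \<Sum>n. f n s) holomorphic_on S"
    using d by (auto simp: holomorphic_on_open[OF S])
  show "summable (\<lambda>n. norm (f n s))" if "s \<in> S"
  proof -
    from dom[OF that] obtain d h where "0 < d" "summable h" "\<forall>n. \<forall>y\<in>ball s d \<inter> S. norm (f n y) \<le> h n" by blast
    then show ?thesis using that by (intro summable_comparison_test'[of h 0 "\<lambda>n. norm (f n s)"]) auto
  qed
  show "(\<lambda>n. deriv (f n) s) sums deriv (\<lambda>s. \<Sum>n. f n s) s" if "s \<in> S"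
    using g(2)[OF that] DERIV_imp_deriv[OF d[OF that]] by simp
qed

definition dirichlet_series :: "(nat \<Rightarrow> real) \<Rightarrow> complex \<Rightarrow> complex" where
  "dirichlet_series a s = (\<Sum>n. of_real (a (Suc n)) * of_nat (Suc n) powr (- s))"

lemma norm_Suc_powr: "norm (of_nat (Suc n) powr s) = real (Suc n) powr Re s"
  by (subst norm_powr_real_powr) auto

lemma summable_ln_powr:
  assumes "\<sigma> > 1"
  shows "summable (\<lambda>n. (ln (real (Suc n)) + 1) * real (Suc n) powr (- \<sigma>))"
proof -
  \<comment> \<open>Half of the surplus of the exponent absorbs the logarithm, the other half keeps the sum convergent.\<close>
  define \<delta> where "\<delta> = (\<sigma> - 1) / 2"
  have \<delta>: "\<delta> > 0" using assms by (simp add: \<delta>_def)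
  have "summable (\<lambda>n. real n powr (\<delta> - \<sigma>))"
    using assms by (subst summable_real_powr_iff) (simp add: \<delta>_def field_simps)
  then have "summable (\<lambda>n. real (Suc n) powr (\<delta> - \<sigma>))" by (subst summable_Suc_iff)
  then have "summable (\<lambda>n. (1 / \<delta> + 1) * real (Suc n) powr (\<delta> - \<sigma>))" by (rule summable_mult)
  then show ?thesis
  proof (rule summable_comparison_test'[of _ 0])
    fix n :: nat
    have "ln (real (Suc n)) \<le> real (Suc n) powr \<delta> / \<delta>" using \<delta> by (intro ln_powr_bound) auto
    moreover have "1 \<le> real (Suc n) powr \<delta>" using \<delta> by (intro ge_one_powr_ge_zero) auto
    ultimately have "ln (real (Suc n)) + 1 \<le> (1 / \<delta> + 1) * real (Suc n) powr \<delta>" by (simp add: algebra_simps)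
    then have "(ln (real (Suc n)) + 1) * real (Suc n) powr (- \<sigma>) \<le> (1 / \<delta> + 1) * real (Suc n) powr \<delta> * real (Suc n) powr (- \<sigma>)"
      by (intro mult_right_mono) auto
    also have "\<dots> = (1 / \<delta> + 1) * real (Suc n) powr (\<delta> - \<sigma>)"
      by (simp add: powr_diff powr_minus field_simps)
    finally show "norm ((ln (real (Suc n)) + 1) * real (Suc n) powr (- \<sigma>)) \<le> (1 / \<delta> + 1) * real (Suc n) powr (\<delta> - \<sigma>)"
      by simp
  qed
qed

text \<open>
  The bound \<open>ln n + 1\<close> on the coefficients is chosen so that it covers both the constant \<open>1\<close> and \<open>\<Lambda>\<close>
  and still gives absolute convergence for \<open>Re s > 1\<close>.
\<close>

lemma dirichlet_series_props:
  assumes a: "\<And>n. n > 0 \<Longrightarrow> \<bar>a n\<bar> \<le> ln (real n) + 1"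
  shows holomorphic_dirichlet_series: "dirichlet_series a holomorphic_on {s. Re s > 1}"
    and abs_summable_dirichlet_series: "Re s > 1 \<Longrightarrow> summable (\<lambda>n. norm (of_real (a (Suc n)) * of_nat (Suc n) powr (- s)))"
    and deriv_dirichlet_series: "Re s > 1 \<Longrightarrow> deriv (dirichlet_series a) s = - dirichlet_series (\<lambda>n. a n * ln (real n)) s"
proof -
  let ?f = "\<lambda>n s. of_real (a (Suc n)) * of_nat (Suc n) powr (- s)"
  let ?S = "{s. Re s > 1}"
  have S: "open ?S" by (rule open_halfspace_Re_gt)
  have hol: "?f n holomorphic_on ?S" for n by (intro holomorphic_intros)
  have dom: "\<exists>d h. 0 < d \<and> summable h \<and> (\<forall>n. \<forall>y\<in>ball x d \<inter> ?S. norm (?f n y) \<le> h n)" if x: "x \<in> ?S" for x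
  proof -
    define d where "d = (Re x - 1) / 2"
    have d: "d > 0" "Re x - d > 1" using x by (auto simp: d_def field_simps)
    have "norm (?f n y) \<le> (ln (real (Suc n)) + 1) * real (Suc n) powr (- (Re x - d))" if "y \<in> ball x d" for n y
    proof -
      have "\<bar>Re (x - y)\<bar> < d" using that abs_Re_le_cmod[of "x - y"] by (simp add: dist_norm)
      then have "Re x - d \<le> Re y" by simp
      then have "real (Suc n) powr (- Re y) \<le> real (Suc n) powr (- (Re x - d))" by (intro powr_mono) auto
      then show ?thesis unfolding norm_mult norm_Suc_powr using a[of "Suc n"]
        by (intro mult_mono) auto
    qed
    then show ?thesis using d summable_ln_powr[OF d(2)] by blast
  qed
  have eq: "dirichlet_series a = (\<lambda>s. \<Sum>n. ?f n s)" by (auto simp: dirichlet_series_def)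
  show "dirichlet_series a holomorphic_on ?S"
    unfolding eq by (rule holomorphic_dominated_series(1)[OF S hol dom])
  show "summable (\<lambda>n. norm (?f n s))" if "Re s > 1"
    by (rule holomorphic_dominated_series(2)[OF S hol dom]) (use that in auto)
  show "deriv (dirichlet_series a) s = - dirichlet_series (\<lambda>n. a n * ln (real n)) s" if s: "Re s > 1"
  proof -
    have "(\<lambda>n. deriv (?f n) s) sums deriv (dirichlet_series a) s"
      unfolding eq by (rule holomorphic_dominated_series(3)[OF S hol dom]) (use s in auto)
    moreover have "deriv (?f n) s = - (of_real (a (Suc n) * ln (real (Suc n))) * of_nat (Suc n) powr (- s))" for n
    proof (rule DERIV_imp_deriv)
      have "((\<lambda>x. of_nat (Suc n) powr (- x) :: complex) has_field_derivative
          (Ln (of_nat (Suc n)) * of_nat (Suc n) powr (- s)) * (- 1)) (at s)"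
        by (rule DERIV_chain2[OF has_field_derivative_powr_right])
          (auto intro!: derivative_eq_intros simp del: of_nat_Suc)
      from DERIV_cmult[OF this, of "of_real (a (Suc n))"]
      show "(?f n has_field_derivative - (of_real (a (Suc n) * ln (real (Suc n))) * of_nat (Suc n) powr (- s))) (at s)"
        by (simp add: Ln_of_nat mult_ac del: of_nat_Suc)
    qed
    ultimately have "(\<lambda>n. - (- (of_real (a (Suc n) * ln (real (Suc n))) * of_nat (Suc n) powr (- s)))) sums (- deriv (dirichlet_series a) s)"
      by (intro sums_minus) simp
    then have "dirichlet_series (\<lambda>n. a n * ln (real n)) s = - deriv (dirichlet_series a) s"
      unfolding dirichlet_series_def by (intro sums_unique[symmetric]) simp
    then show ?thesis by simp
  qed
qed

lemma dirichlet_series_has_sum: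
  assumes "summable (\<lambda>n. norm (of_real (a (Suc n)) * of_nat (Suc n) powr (- s) :: complex))"
  shows "((\<lambda>n. of_real (a n) * of_nat n powr (- s)) has_sum dirichlet_series a s) {1..}"
    and "(\<lambda>n. norm (of_real (a n) * of_nat n powr (- s) :: complex)) summable_on {1..}"
proof -
  have bij: "bij_betw Suc UNIV {1::nat..}"
    by (rule bij_betwI[of _ _ _ "\<lambda>n. n - 1"]) auto
  have "((\<lambda>n. of_real (a (Suc n)) * of_nat (Suc n) powr (- s)) has_sum dirichlet_series a s) UNIV"
    unfolding dirichlet_series_def
    by (rule norm_summable_imp_has_sum[OF assms summable_sums[OF summable_norm_cancel[OF assms]]])
  then show "((\<lambda>n. of_real (a n) * of_nat n powr (- s)) has_sum dirichlet_series a s) {1..}"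
    using has_sum_reindex_bij_betw[OF bij, of "\<lambda>n. of_real (a n) * of_nat n powr (- s)"] by simp
  have "(\<lambda>n. norm (of_real (a (Suc n)) * of_nat (Suc n) powr (- s) :: complex)) summable_on UNIV"
    using assms by (subst summable_on_UNIV_nonneg_real_iff) auto
  then show "(\<lambda>n. norm (of_real (a n) * of_nat n powr (- s) :: complex)) summable_on {1..}"
    using summable_on_reindex_bij_betw[OF bij, of "\<lambda>n. norm (of_real (a n) * of_nat n powr (- s) :: complex)"] by simp
qed

text \<open>
  Both series converge absolutely, so the double series may be rearranged; grouping the pairs
  \<open>(m, d)\<close> by the product \<open>k = m d\<close> gives the Dirichlet convolution.
\<close>

lemma dirichlet_series_mult:
  assumes a: "summable (\<lambda>n. norm (of_real (a (Suc n)) * of_nat (Suc n) powr (- s) :: complex))"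
    and b: "summable (\<lambda>n. norm (of_real (b (Suc n)) * of_nat (Suc n) powr (- s) :: complex))"
  shows "dirichlet_series a s * dirichlet_series b s = dirichlet_series (\<lambda>n. \<Sum>d | d dvd n. a (n div d) * b d) s"
proof -
  let ?t = "\<lambda>c n. of_real (c n) * of_nat n powr (- s) :: complex"
  let ?A = "{1::nat..}"
  let ?f = "\<lambda>(m, n). ?t a m * ?t b n"
  let ?D = "Sigma ?A (\<lambda>k. {d. d dvd k})"
  let ?g = "\<lambda>(k, d). (k div d, d :: nat)"
  note sa = dirichlet_series_has_sum[OF a] and sb = dirichlet_series_has_sum[OF b]
  have "(\<lambda>p. norm (?f p)) summable_on ?A \<times> ?A"
    unfolding Infinite_Sum.abs_summable_on_Sigma_iff
  proof (intro conjI ballI)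
    fix m
    show "(\<lambda>n. norm (?f (m, n))) summable_on ?A"
      using summable_on_cmult_right[OF sb(2), of "norm (?t a m)"] by (simp add: norm_mult)
    have "(\<lambda>m. norm (?t a m) * infsum (\<lambda>n. norm (?t b n)) ?A) summable_on ?A"
      by (rule summable_on_cmult_left[OF sa(2)])
    moreover have "infsum (\<lambda>n. norm (?f (m, n))) ?A = norm (?t a m) * infsum (\<lambda>n. norm (?t b n)) ?A" for m
      by (subst infsum_cmult_right'[symmetric]) (simp add: norm_mult)
    ultimately show "(\<lambda>m. norm (infsum (\<lambda>n. norm (?f (m, n))) ?A)) summable_on ?A"
      by (simp add: infsum_nonneg)
  qed
  then have summ: "?f summable_on ?A \<times> ?A" by (rule Infinite_Sum.abs_summable_summable)
  have "dirichlet_series a s * dirichlet_series b s = infsum (?t a) ?A * infsum (?t b) ?A"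
    using infsumI[OF sa(1)] infsumI[OF sb(1)] by simp
  also have "\<dots> = infsum (\<lambda>m. infsum (\<lambda>n. ?f (m, n)) ?A) ?A"
    by (simp add: infsum_cmult_right' infsum_cmult_left')
  also have "\<dots> = infsum ?f (?A \<times> ?A)" by (rule infsum_Sigma_banach[OF summ])
  finally have prod: "(?f has_sum dirichlet_series a s * dirichlet_series b s) (?A \<times> ?A)"
    using summ by (simp add: has_sum_infsum)
  have bij: "bij_betw ?g ?D (?A \<times> ?A)"
    by (rule bij_betwI[of _ _ _ "\<lambda>(m, d). (m * d, d)"])
      (auto simp: Suc_le_eq dvd_pos_nat div_greater_zero_iff dvd_imp_le)
  have "((\<lambda>x. ?f (?g x)) has_sum dirichlet_series a s * dirichlet_series b s) ?D"
    using prod has_sum_reindex_bij_betw[OF bij, of ?f] by simp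
  moreover have "((\<lambda>d. ?f (?g (k, d))) has_sum ?t (\<lambda>n. \<Sum>d | d dvd n. a (n div d) * b d) k) {d. d dvd k}"
    if k: "k \<in> ?A" for k
  proof -
    have "((\<lambda>d. ?f (?g (k, d))) has_sum (\<Sum>d | d dvd k. ?f (?g (k, d)))) {d. d dvd k}"
      using k by (intro has_sum_finite finite_divisors_nat) auto
    also have "(\<Sum>d | d dvd k. ?f (?g (k, d))) = (\<Sum>d | d dvd k. of_real (a (k div d) * b d) * of_nat k powr (- s))"
    proof (rule sum.cong)
      fix d assume "d \<in> {d. d dvd k}"
      then have "of_nat k = (of_nat (k div d) * of_nat d :: complex)" by (simp flip: of_nat_mult)
      then have "of_nat k powr (- s) = of_nat (k div d) powr (- s) * of_nat d powr (- s)"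
        by (simp add: powr_times_real)
      then show "?f (?g (k, d)) = of_real (a (k div d) * b d) * of_nat k powr (- s)" by simp
    qed simp
    finally show ?thesis by (simp add: sum_distrib_right)
  qed
  ultimately have hs: "(?t (\<lambda>n. \<Sum>d | d dvd n. a (n div d) * b d) has_sum dirichlet_series a s * dirichlet_series b s) ?A"
    by (rule has_sum_SigmaD)
  have bijS: "bij_betw Suc UNIV {1::nat..}"
    by (rule bij_betwI[of _ _ _ "\<lambda>n. n - 1"]) auto
  have "((\<lambda>n. ?t (\<lambda>n. \<Sum>d | d dvd n. a (n div d) * b d) (Suc n)) has_sum dirichlet_series a s * dirichlet_series b s) UNIV"
    using has_sum_reindex_bij_betw[OF bijS, THEN iffD2, OF hs] .
  then show ?thesis unfolding dirichlet_series_def[of "\<lambda>n. \<Sum>d | d dvd n. a (n div d) * b d"]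
    by (intro sums_unique has_sum_imp_sums)
qed

abbreviation zeta_series :: "complex \<Rightarrow> complex" where
  "zeta_series \<equiv> dirichlet_series (\<lambda>_. 1)"

lemma one_coeff_bound: "n > 0 \<Longrightarrow> \<bar>1 :: real\<bar> \<le> ln (real n) + 1"
  by simp

lemma mangoldt_coeff_bound: "n > 0 \<Longrightarrow> \<bar>mangoldt n :: real\<bar> \<le> ln (real n) + 1"
  using mangoldt_le[of n] by simp

text \<open>
  This is \<open>\<Lambda> * 1 = ln\<close> read as an identity of Dirichlet series. It is kept free of division, as
  nothing is known about zeros of \<open>\<zeta>\<close> at this point.
\<close>

lemma zeta_series_mult_mangoldt:
  assumes "Re s > 1"
  shows "zeta_series s * dirichlet_series mangoldt s = - deriv zeta_series s"
proof -
  have "zeta_series s * dirichlet_series mangoldt s = dirichlet_series (\<lambda>n. \<Sum>d | d dvd n. mangoldt d) s"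
    using dirichlet_series_mult[of "\<lambda>_. 1" s mangoldt]
      abs_summable_dirichlet_series[OF one_coeff_bound assms] abs_summable_dirichlet_series[OF mangoldt_coeff_bound assms]
    by simp
  also have "\<dots> = dirichlet_series (\<lambda>n. 1 * ln (real n)) s"
    unfolding dirichlet_series_def using mangoldt_sum[where ?'a = real] by simp
  also have "\<dots> = - deriv zeta_series s"
    using deriv_dirichlet_series[OF one_coeff_bound assms] by simp
  finally show ?thesis .
qed

section \<open>Continuation of the zeta function past its pole\<close>

text \<open>
  These terms compare \<open>(s - 1) n\<^bsup>-s\<^esup>\<close> with the integral of \<open>(s - 1) u\<^bsup>-s\<^esup>\<close> over \<open>[n, n + 1]\<close>, written
  out as a difference of powers. With the factor \<open>s - 1\<close> in front, the pole of \<open>\<zeta>\<close> at \<open>1\<close>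
  disappears and no removable singularity has to be filled.
\<close>

definition zeta_term :: "nat \<Rightarrow> complex \<Rightarrow> complex" where
  "zeta_term n s = (s - 1) * of_nat (Suc n) powr (- s) + of_nat (Suc (Suc n)) powr (1 - s) - of_nat (Suc n) powr (1 - s)"

text \<open>
  The function \<open>(s - 1) \<zeta>(s)\<close>, continued to \<open>Re s > 0\<close>.
\<close>

definition zeta_reg :: "complex \<Rightarrow> complex" where
  "zeta_reg s = 1 + (\<Sum>n. zeta_term n s)"

lemma segment_nat_Suc:
  assumes "w \<in> closed_segment (of_nat (Suc n)) (of_nat (Suc (Suc n)) :: complex)"
  shows "w \<in> \<real>" "real (Suc n) \<le> Re w" "w \<notin> \<real>\<^sub>\<le>\<^sub>0" "norm (w - of_nat (Suc n)) \<le> 1"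
proof -
  obtain u where u: "0 \<le> u" "u \<le> 1" and "w = (1 - u) *\<^sub>R of_nat (Suc n) + u *\<^sub>R of_nat (Suc (Suc n))"
    using assms by (auto simp: closed_segment_def)
  then have w: "w = of_real (real (Suc n) + u)" by (simp add: scaleR_conv_of_real algebra_simps)
  show "w \<in> \<real>" "real (Suc n) \<le> Re w" "w \<notin> \<real>\<^sub>\<le>\<^sub>0" using u unfolding w
    by (simp_all add: complex_nonpos_Reals_iff)
  have "w - of_nat (Suc n) = of_real u" unfolding w by simp
  then show "norm (w - of_nat (Suc n)) \<le> 1" using u by (simp add: norm_of_real)
qed

lemma norm_powr_diff_le:
  assumes s: "Re s > -1" and w: "w \<in> closed_segment (of_nat (Suc n)) (of_nat (Suc (Suc n)))"
  shows "norm (w powr (- s) - of_nat (Suc n) powr (- s)) \<le> norm s * real (Suc n) powr (- Re s - 1)"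
proof -
  let ?S = "closed_segment (of_nat (Suc n)) (of_nat (Suc (Suc n))) :: complex set"
  have "norm (w powr (- s) - of_nat (Suc n) powr (- s)) \<le> (norm s * real (Suc n) powr (- Re s - 1)) * norm (w - of_nat (Suc n))"
  proof (rule field_differentiable_bound[of ?S])
    fix v assume v: "v \<in> ?S"
    note v' = segment_nat_Suc[OF v]
    show "((\<lambda>v. v powr (- s)) has_field_derivative (- s) * v powr (- s - 1)) (at v within ?S)"
      by (rule has_field_derivative_at_within[OF has_field_derivative_powr[OF v'(3)]])
    have "norm (v powr (- s - 1)) = Re v powr (- Re s - 1)"
      using v' by (subst norm_powr_real_powr) auto
    also have "\<dots> \<le> real (Suc n) powr (- Re s - 1)"
      using v' s by (intro powr_mono2') auto
    finally show "norm ((- s) * v powr (- s - 1)) \<le> norm s * real (Suc n) powr (- Re s - 1)"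
      by (simp add: norm_mult mult_left_mono)
  qed (use w in auto)
  also have "\<dots> \<le> (norm s * real (Suc n) powr (- Re s - 1)) * 1"
    using segment_nat_Suc(4)[OF w] by (intro mult_left_mono) auto
  finally show ?thesis by simp
qed

text \<open>
  The term is the increment over \<open>[n, n + 1]\<close> of a function whose derivative is
  \<open>(s - 1) (n\<^bsup>-s\<^esup> - v\<^bsup>-s\<^esup>)\<close>, and that difference is bounded in turn by the mean value theorem. The
  two steps gain one power of \<open>n\<close>, so the series converges for \<open>Re s > 0\<close>.
\<close>

lemma norm_zeta_term_le:
  assumes s: "Re s > -1"
  shows "norm (zeta_term n s) \<le> norm (s - 1) * norm s * real (Suc n) powr (- Re s - 1)"
proof -
  let ?S = "closed_segment (of_nat (Suc n)) (of_nat (Suc (Suc n))) :: complex set"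
  let ?F = "\<lambda>v. (s - 1) * (v - of_nat (Suc n)) * of_nat (Suc n) powr (- s) + v powr (1 - s)"
  have eq: "zeta_term n s = ?F (of_nat (Suc (Suc n))) - ?F (of_nat (Suc n))"
    by (simp add: zeta_term_def)
  have "norm (?F (of_nat (Suc (Suc n))) - ?F (of_nat (Suc n)))
      \<le> (norm (s - 1) * (norm s * real (Suc n) powr (- Re s - 1))) * norm (of_nat (Suc (Suc n)) - of_nat (Suc n) :: complex)"
  proof (rule field_differentiable_bound[of ?S])
    fix v assume v: "v \<in> ?S"
    note v' = segment_nat_Suc[OF v]
    have d: "((\<lambda>v. v powr (1 - s)) has_field_derivative (1 - s) * v powr (- s)) (at v within ?S)"
      using has_field_derivative_at_within[OF has_field_derivative_powr[OF v'(3), of "1 - s"]] by simp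
    have "((\<lambda>v. (s - 1) * (v - of_nat (Suc n)) * of_nat (Suc n) powr (- s)) has_field_derivative (s - 1) * of_nat (Suc n) powr (- s)) (at v within ?S)"
      by (auto intro!: derivative_eq_intros)
    from DERIV_add[OF this d]
    show "(?F has_field_derivative (s - 1) * of_nat (Suc n) powr (- s) + (1 - s) * v powr (- s)) (at v within ?S)" .
    have "(s - 1) * of_nat (Suc n) powr (- s) + (1 - s) * v powr (- s) = - ((s - 1) * (v powr (- s) - of_nat (Suc n) powr (- s)))"
      by (simp add: algebra_simps)
    then show "norm ((s - 1) * of_nat (Suc n) powr (- s) + (1 - s) * v powr (- s)) \<le> norm (s - 1) * (norm s * real (Suc n) powr (- Re s - 1))"
      using norm_powr_diff_le[OF s v] by (simp only: norm_minus_cancel norm_mult) (intro mult_left_mono; simp)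
  qed auto
  then show ?thesis unfolding eq[symmetric] by (simp add: mult_ac)
qed

lemma zeta_term_dominated:
  assumes x: "Re x > 0"
  shows "\<exists>d h. 0 < d \<and> summable h \<and> (\<forall>n. \<forall>y\<in>ball x d \<inter> S. norm (zeta_term n y) \<le> h n)"
proof -
  define d where "d = Re x / 2"
  have d: "d > 0" "Re x - d > 0" using x by (auto simp: d_def)
  define h where "h n = (norm x + d + 1) * (norm x + d) * real (Suc n) powr (- (Re x - d) - 1)" for n
  have "summable (\<lambda>n. real n powr (- (Re x - d) - 1))"
    using d by (subst summable_real_powr_iff) auto
  then have "summable (\<lambda>n. real (Suc n) powr (- (Re x - d) - 1))" by (subst summable_Suc_iff)
  then have "summable h" unfolding h_def by (rule summable_mult)
  moreover have "norm (zeta_term n y) \<le> h n" if "y \<in> ball x d" for n y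
  proof -
    have dist: "norm (x - y) < d" using that by (simp add: dist_norm)
    have "\<bar>Re (x - y)\<bar> < d" using dist abs_Re_le_cmod[of "x - y"] by simp
    then have Re: "Re x - d \<le> Re y" by simp
    have "norm y \<le> norm x + d" using dist norm_triangle_ineq2[of y x] by (simp add: norm_minus_commute)
    moreover from this have "norm (y - 1) \<le> norm x + d + 1" using norm_triangle_ineq4[of y 1] by simp
    moreover have "real (Suc n) powr (- Re y - 1) \<le> real (Suc n) powr (- (Re x - d) - 1)"
      using Re by (intro powr_mono) auto
    moreover have "norm (zeta_term n y) \<le> norm (y - 1) * norm y * real (Suc n) powr (- Re y - 1)"
      using Re d by (intro norm_zeta_term_le) auto
    ultimately show ?thesis unfolding h_def using d
      by (elim order_trans) (intro mult_mono; simp)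
  qed
  ultimately show ?thesis using d by blast
qed

lemma holomorphic_zeta_reg: "zeta_reg holomorphic_on {s. Re s > 0}"
proof -
  have "(\<lambda>s. \<Sum>n. zeta_term n s) holomorphic_on {s. Re s > 0}"
  proof (rule holomorphic_dominated_series(1)[OF open_halfspace_Re_gt])
    show "\<And>n. zeta_term n holomorphic_on {s. Re s > 0}"
      unfolding zeta_term_def by (intro holomorphic_intros)
  qed (use zeta_term_dominated in auto)
  then have "(\<lambda>s. 1 + (\<Sum>n. zeta_term n s)) holomorphic_on {s. Re s > 0}" by (intro holomorphic_intros)
  then show ?thesis by (simp add: zeta_reg_def[abs_def])
qed

lemma zeta_reg_1 [simp]: "zeta_reg 1 = 1"
  by (simp add: zeta_reg_def zeta_term_def del: of_nat_Suc)

lemma Suc_powr_tendsto_0: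
  assumes "Re s < 0"
  shows "(\<lambda>n. of_nat (Suc n) powr s :: complex) \<longlonglongrightarrow> 0"
proof (rule tendsto_norm_zero_cancel)
  have "(\<lambda>n. real (Suc n) powr Re s) \<longlonglongrightarrow> 0"
    using assms by (intro tendsto_neg_powr filterlim_compose[OF filterlim_real_sequentially filterlim_Suc])
  then show "(\<lambda>n. norm (of_nat (Suc n) powr s :: complex)) \<longlonglongrightarrow> 0"
    by (simp only: norm_Suc_powr)
qed

text \<open>
  For \<open>Re s > 1\<close> the differences of powers telescope to \<open>-1\<close>, which the leading \<open>1\<close> cancels.
\<close>

lemma zeta_reg_eq:
  assumes s: "Re s > 1"
  shows "zeta_reg s = (s - 1) * zeta_series s"
proof -
  have "summable (\<lambda>n. of_nat (Suc n) powr (- s) :: complex)"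
    using summable_norm_cancel[OF abs_summable_dirichlet_series[OF one_coeff_bound s]] by simp
  then have "(\<lambda>n. (s - 1) * of_nat (Suc n) powr (- s)) sums ((s - 1) * zeta_series s)"
    unfolding dirichlet_series_def by (intro sums_mult) (simp add: summable_sums)
  moreover have "(\<lambda>n. of_nat (Suc (Suc n)) powr (1 - s) - of_nat (Suc n) powr (1 - s)) sums (0 - of_nat (Suc 0) powr (1 - s) :: complex)"
    using s by (intro telescope_sums Suc_powr_tendsto_0) auto
  ultimately have "(\<lambda>n. (s - 1) * of_nat (Suc n) powr (- s) + (of_nat (Suc (Suc n)) powr (1 - s) - of_nat (Suc n) powr (1 - s))) sums ((s - 1) * zeta_series s + (0 - of_nat (Suc 0) powr (1 - s)))"
    by (rule sums_add)
  then have "(\<lambda>n. zeta_term n s) sums ((s - 1) * zeta_series s - 1)"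
    by (simp add: zeta_term_def[abs_def] add_diff_eq)
  then show ?thesis by (simp add: zeta_reg_def sums_iff)
qed

text \<open>
  The logarithmic derivative in product form, so that it can be used before \<open>\<zeta>\<close> is known to have
  no zeros.
\<close>

lemma deriv_zeta_reg_eq:
  assumes s: "Re s > 1"
  shows "deriv zeta_reg s = zeta_reg s * (1 / (s - 1) - dirichlet_series mangoldt s)"
proof -
  have op: "open {s. Re s > 1}" by (rule open_halfspace_Re_gt)
  have dz: "(zeta_series has_field_derivative deriv zeta_series s) (at s)"
    using holomorphic_derivI[OF holomorphic_dirichlet_series[OF one_coeff_bound] op] s by simp
  then have "((\<lambda>s. (s - 1) * zeta_series s) has_field_derivative zeta_series s + (s - 1) * deriv zeta_series s) (at s)"
    by (auto intro!: derivative_eq_intros)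
  then have "(zeta_reg has_field_derivative zeta_series s + (s - 1) * deriv zeta_series s) (at s)"
    by (rule has_field_derivative_transform_within_open[OF _ op]) (use s zeta_reg_eq in auto)
  then have "deriv zeta_reg s = zeta_series s + (s - 1) * deriv zeta_series s" by (rule DERIV_imp_deriv)
  moreover have "deriv zeta_series s = - (zeta_series s * dirichlet_series mangoldt s)"
    using zeta_series_mult_mangoldt[OF s] by simp
  moreover have "s \<noteq> 1" using s by auto
  moreover from this have "(s - 1) * zeta_series s * (1 / (s - 1) - dirichlet_series mangoldt s)
      = zeta_series s - (s - 1) * (zeta_series s * dirichlet_series mangoldt s)"
    by (simp add: right_diff_distrib)
  ultimately show ?thesis unfolding zeta_reg_eq[OF s] by simp
qed

section \<open>Non-vanishing on the line with real part one\<close>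

lemma isCont_holomorphic: "f holomorphic_on S \<Longrightarrow> open S \<Longrightarrow> z \<in> S \<Longrightarrow> isCont f z"
  by (rule field_differentiable_imp_continuous_at[OF holomorphic_on_imp_differentiable_at])

text \<open>
  Near \<open>z\<close> a function that is not identically zero factors as \<open>(w - z)\<^bsup>m\<^esup>\<close> times a zero-free
  function, so its logarithmic derivative has a simple pole with residue \<open>m\<close>. Stated as a limit,
  this lets the order of vanishing be read off along any path to \<open>z\<close>.
\<close>

lemma log_deriv_residue:
  fixes f :: "complex \<Rightarrow> complex"
  assumes f: "f holomorphic_on S" and S: "open S" "connected S" "z \<in> S"
    and nz: "\<exists>w\<in>S. f w \<noteq> 0"
  shows "\<exists>m::nat. ((\<lambda>w. (w - z) * (deriv f w / f w)) \<longlongrightarrow> of_nat m) (at z) \<and> (f z = 0 \<longrightarrow> m > 0)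
     \<and> eventually (\<lambda>w. f w \<noteq> 0) (at z)"
proof (cases "f z = 0")
  case False
  have "isCont (deriv f) z" "isCont f z"
    using isCont_holomorphic[OF f S(1,3)] isCont_holomorphic[OF holomorphic_deriv[OF f S(1)] S(1,3)] by simp_all
  then have "((\<lambda>w. (w - z) * (deriv f w / f w)) \<longlongrightarrow> (z - z) * (deriv f z / f z)) (at z)"
    using False by (intro tendsto_intros) (auto simp: isCont_def)
  moreover have "eventually (\<lambda>w. f w \<noteq> 0) (at z)"
    using \<open>isCont f z\<close> False by (auto simp: isCont_def intro: tendsto_imp_eventually_ne)
  ultimately show ?thesis using False by (intro exI[of _ 0]) auto
next
  case True
  then have "\<not> f constant_on S" using nz S(3) unfolding constant_on_def by metis
  from holomorphic_factor_zero_nonconstant[OF f S True this]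
  obtain g r n where gn: "0 < n" "0 < r" "ball z r \<subseteq> S" "g holomorphic_on ball z r"
    "\<And>w. w \<in> ball z r \<Longrightarrow> f w = (w - z) ^ n * g w" "\<And>w. w \<in> ball z r \<Longrightarrow> g w \<noteq> 0" by metis
  have g: "isCont (deriv g) z" "isCont g z"
    using gn(2) by (auto intro!: isCont_holomorphic[of _ "ball z r"] holomorphic_deriv gn(4))
  have ev: "eventually (\<lambda>w. w \<in> ball z r - {z}) (at z)"
    using gn(2) eventually_at_ball'[of r z UNIV] by (auto elim: eventually_mono)
  have eq: "(w - z) * (deriv f w / f w) = of_nat n + (w - z) * (deriv g w / g w)" if w: "w \<in> ball z r - {z}" for w
  proof -
    have "(g has_field_derivative deriv g w) (at w)"
      using holomorphic_derivI[OF gn(4)] w by auto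
    then have "((\<lambda>w. (w - z) ^ n * g w) has_field_derivative
        of_nat n * (w - z) ^ (n - 1) * g w + (w - z) ^ n * deriv g w) (at w)"
      by (auto intro!: derivative_eq_intros)
    then have "(f has_field_derivative of_nat n * (w - z) ^ (n - 1) * g w + (w - z) ^ n * deriv g w) (at w)"
      by (rule has_field_derivative_transform_within_open[of _ _ _ "ball z r"]) (use w gn(5) in auto)
    then have d: "deriv f w = of_nat n * (w - z) ^ (n - 1) * g w + (w - z) ^ n * deriv g w"
      by (rule DERIV_imp_deriv)
    have "(w - z) ^ n = (w - z) * (w - z) ^ (n - 1)" using gn(1) by (simp flip: power_Suc)
    moreover have "D * ((N * P * G + D * P * G') / (D * P * G)) = N + D * (G' / G)"
      if "D \<noteq> 0" "P \<noteq> 0" "G \<noteq> 0" for D P G G' N :: complex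
      using that by (simp add: field_simps)
    ultimately show ?thesis using w gn(5)[of w] gn(6)[of w] unfolding d by simp
  qed
  have "((\<lambda>w. of_nat n + (w - z) * (deriv g w / g w)) \<longlongrightarrow> of_nat n + (z - z) * (deriv g z / g z)) (at z)"
    using g gn(6)[of z] gn(2) by (intro tendsto_intros) (auto simp: isCont_def)
  then have "((\<lambda>w. (w - z) * (deriv f w / f w)) \<longlongrightarrow> of_nat n) (at z)"
    by (subst tendsto_cong[OF eventually_mono[OF ev eq]]) auto
  moreover have "eventually (\<lambda>w. f w \<noteq> 0) (at z)"
    using ev by eventually_elim (use gn(5,6) in auto)
  ultimately show ?thesis using gn(1) by blast
qed

lemma zeta_reg_residue:
  assumes "Re z > 0"
  shows "\<exists>m::nat. ((\<lambda>w. (w - z) * (deriv zeta_reg w / zeta_reg w)) \<longlongrightarrow> of_nat m) (at z) \<and> (zeta_reg z = 0 \<longrightarrow> m > 0)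
     \<and> eventually (\<lambda>w. zeta_reg w \<noteq> 0) (at z)"
  by (rule log_deriv_residue[OF holomorphic_zeta_reg open_halfspace_Re_gt convex_connected[OF convex_halfspace_Re_gt]])
    (use assms zeta_reg_1 in \<open>simp_all, metis one_complex.sel(1) zero_less_one zero_neq_one zeta_reg_1\<close>)

text \<open>
  Where the series for \<open>\<Lambda>\<close> converges, \<open>deriv_zeta_reg_eq\<close> bounds the logarithmic derivative
  near \<open>z\<close>, while a zero would give it a pole.
\<close>

lemma zeta_reg_nonzero_Re_gt_1:
  assumes z: "Re z > 1"
  shows "zeta_reg z \<noteq> 0"
proof
  assume "zeta_reg z = 0"
  then obtain m :: nat where m: "((\<lambda>w. (w - z) * (deriv zeta_reg w / zeta_reg w)) \<longlongrightarrow> of_nat m) (at z)" "m > 0"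
      "eventually (\<lambda>w. zeta_reg w \<noteq> 0) (at z)"
    using zeta_reg_residue[of z] z by auto
  have "eventually (\<lambda>w. w \<in> {w. Re w > 1}) (at z)"
    using z by (intro eventually_at_in_open' open_halfspace_Re_gt) auto
  with m(3) have ev: "eventually (\<lambda>w. (w - z) * (deriv zeta_reg w / zeta_reg w) = (w - z) * (1 / (w - 1) - dirichlet_series mangoldt w)) (at z)"
    by eventually_elim (simp add: deriv_zeta_reg_eq)
  have "isCont (dirichlet_series mangoldt) z"
    using z by (intro isCont_holomorphic[OF holomorphic_dirichlet_series[OF mangoldt_coeff_bound] open_halfspace_Re_gt]) auto
  then have "((\<lambda>w. (w - z) * (1 / (w - 1) - dirichlet_series mangoldt w)) \<longlongrightarrow> (z - z) * (1 / (z - 1) - dirichlet_series mangoldt z)) (at z)"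
    using z by (intro tendsto_intros) (auto simp: isCont_def)
  then have "((\<lambda>w. (w - z) * (deriv zeta_reg w / zeta_reg w)) \<longlongrightarrow> 0) (at z)"
    by (subst tendsto_cong[OF ev]) auto
  with m(1) have "of_nat m = (0::complex)" by (intro tendsto_unique[OF at_neq_bot])
  with m(2) show False by simp
qed

text \<open>
  Mertens' inequality: the coefficients satisfy \<open>\<Lambda>(n) \<ge> 0\<close>, and
  \<open>3 + 4 cos \<phi> + cos (2 \<phi>) = 2 (1 + cos \<phi>)\<^sup>2 \<ge> 0\<close>.
\<close>

lemma three_four_one_mangoldt:
  assumes "\<sigma> > 1"
  shows "3 * Re (dirichlet_series mangoldt (of_real \<sigma>)) + 4 * Re (dirichlet_series mangoldt (Complex \<sigma> t))
      + Re (dirichlet_series mangoldt (Complex \<sigma> (2 * t))) \<ge> 0"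
proof -
  let ?f = "\<lambda>s n. of_real (mangoldt (Suc n)) * of_nat (Suc n) powr (- s) :: complex"
  have sums: "(\<lambda>n. Re (?f s n)) sums Re (dirichlet_series mangoldt s)" if "Re s > 1" for s
    unfolding dirichlet_series_def
    by (rule sums_Re[OF summable_sums[OF summable_norm_cancel[OF abs_summable_dirichlet_series[OF mangoldt_coeff_bound that]]]])
  have Re: "Re (?f (Complex \<sigma> u) n) = mangoldt (Suc n) * real (Suc n) powr (- \<sigma>) * cos (u * ln (real (Suc n)))" for u n
  proof -
    have "of_nat (Suc n) powr (- Complex \<sigma> u) = exp (of_real (ln (real (Suc n))) * (- Complex \<sigma> u) :: complex)"
      by (simp add: powr_def Ln_of_nat mult_ac del: of_nat_Suc)
    then have "Re (of_nat (Suc n) powr (- Complex \<sigma> u) :: complex) = real (Suc n) powr (- \<sigma>) * cos (u * ln (real (Suc n)))"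
      by (simp add: Re_exp powr_def mult_ac del: of_nat_Suc)
    then show ?thesis by (simp del: of_nat_Suc)
  qed
  have "0 \<le> (\<Sum>n. 3 * Re (?f (Complex \<sigma> 0) n) + 4 * Re (?f (Complex \<sigma> t) n) + Re (?f (Complex \<sigma> (2 * t)) n))"
  proof (rule suminf_nonneg)
    show "summable (\<lambda>n. 3 * Re (?f (Complex \<sigma> 0) n) + 4 * Re (?f (Complex \<sigma> t) n) + Re (?f (Complex \<sigma> (2 * t)) n))"
      using assms by (intro summable_add summable_mult sums_summable[OF sums]) auto
    fix n
    have "0 \<le> 2 * (1 + cos (t * ln (real (Suc n))))\<^sup>2" by simp
    also have "\<dots> = 3 + 4 * cos (t * ln (real (Suc n))) + cos (2 * (t * ln (real (Suc n))))"
      unfolding cos_double_cos by (simp add: power2_eq_square algebra_simps)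
    finally have "0 \<le> (mangoldt (Suc n) * real (Suc n) powr (- \<sigma>)) * (3 + 4 * cos (t * ln (real (Suc n))) + cos (2 * t * ln (real (Suc n))))"
      by (intro mult_nonneg_nonneg mangoldt_nonneg) (auto simp: mult_ac)
    then show "0 \<le> 3 * Re (?f (Complex \<sigma> 0) n) + 4 * Re (?f (Complex \<sigma> t) n) + Re (?f (Complex \<sigma> (2 * t)) n)"
      unfolding Re by (simp add: algebra_simps)
  qed
  also have "\<dots> = 3 * Re (dirichlet_series mangoldt (Complex \<sigma> 0)) + 4 * Re (dirichlet_series mangoldt (Complex \<sigma> t))
      + Re (dirichlet_series mangoldt (Complex \<sigma> (2 * t)))"
    using assms by (intro sums_unique[symmetric] sums_add sums_mult sums) auto
  finally show ?thesis by (simp add: complex_of_real_def)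
qed

text \<open>
  Let \<open>m0\<close>, \<open>m1\<close>, \<open>m2\<close> be the orders of vanishing of \<open>zeta_reg\<close> at \<open>1\<close>, \<open>1 + i t\<close> and \<open>1 + 2 i t\<close>.
  Multiplying \<open>three_four_one_mangoldt\<close> at \<open>\<sigma> = 1 + x\<close> by \<open>x\<close> and letting \<open>x\<close> decrease to \<open>0\<close> leaves
  \<open>3 (1 - m0) - 4 m1 - m2 \<ge> 0\<close>, where the \<open>1\<close> is the residue of the pole at \<open>1\<close>. Hence \<open>m1 \<ge> 1\<close>
  is impossible.
\<close>

lemma zeta_reg_nonzero_Re_eq_1:
  assumes z: "Re z = 1"
  shows "zeta_reg z \<noteq> 0"
proof
  assume zero: "zeta_reg z = 0"
  define t where "t = Im z"
  have z_eq: "z = Complex 1 t" using z by (simp add: t_def complex_eq_iff)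
  have t: "t \<noteq> 0" using zero zeta_reg_1 unfolding z_eq by (metis zero_neq_one one_complex.code)
  have lim: "\<exists>m::nat. ((\<lambda>x. x * Re (deriv zeta_reg (Complex (1 + x) u) / zeta_reg (Complex (1 + x) u))) \<longlongrightarrow> of_nat m) (at_right 0) \<and> (zeta_reg (Complex 1 u) = 0 \<longrightarrow> m > 0)" for u
  proof -
    obtain m :: nat where m: "((\<lambda>w. (w - Complex 1 u) * (deriv zeta_reg w / zeta_reg w)) \<longlongrightarrow> of_nat m) (at (Complex 1 u))" "zeta_reg (Complex 1 u) = 0 \<longrightarrow> m > 0"
      using zeta_reg_residue[of "Complex 1 u"] by auto
    have "((\<lambda>x. Complex 1 u + of_real x) \<longlongrightarrow> Complex 1 u + of_real 0) (at_right 0)"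
      by (intro tendsto_intros)
    then have "filterlim (\<lambda>x. Complex 1 u + of_real x) (at (Complex 1 u)) (at_right 0)"
      by (auto simp: filterlim_at eventually_at_filter)
    from filterlim_compose[OF m(1) this]
    have "((\<lambda>x. of_real x * (deriv zeta_reg (Complex 1 u + of_real x) / zeta_reg (Complex 1 u + of_real x))) \<longlongrightarrow> of_nat m) (at_right 0)"
      by simp
    from tendsto_Re[OF this]
    have "((\<lambda>x. x * Re (deriv zeta_reg (Complex 1 u + of_real x) / zeta_reg (Complex 1 u + of_real x))) \<longlongrightarrow> of_nat m) (at_right 0)"
      by (simp only: times_complex.sel Re_complex_of_real Im_complex_of_real mult_zero_left diff_zero complex_Re_of_nat)
    moreover have "Complex 1 u + of_real x = Complex (1 + x) u" for x by (simp add: complex_eq_iff)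
    ultimately show ?thesis using m(2) by auto
  qed
  obtain m0 m1 m2 :: nat where
    m0: "((\<lambda>x. x * Re (deriv zeta_reg (Complex (1 + x) 0) / zeta_reg (Complex (1 + x) 0))) \<longlongrightarrow> of_nat m0) (at_right 0)"
    and m1: "((\<lambda>x. x * Re (deriv zeta_reg (Complex (1 + x) t) / zeta_reg (Complex (1 + x) t))) \<longlongrightarrow> of_nat m1) (at_right 0)" "m1 > 0"
    and m2: "((\<lambda>x. x * Re (deriv zeta_reg (Complex (1 + x) (2 * t)) / zeta_reg (Complex (1 + x) (2 * t)))) \<longlongrightarrow> of_nat m2) (at_right 0)"
    using lim[of 0] lim[of t] lim[of "2 * t"] zero z_eq by blast
  have inv: "((\<lambda>x. x * Re (1 / (Complex (1 + x) u - 1))) \<longlongrightarrow> 0) (at_right 0)" if "u \<noteq> 0" for u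
  proof -
    have "((\<lambda>x. x * (x / (x\<^sup>2 + u\<^sup>2))) \<longlongrightarrow> 0 * (0 / (0\<^sup>2 + u\<^sup>2))) (at_right 0)"
      using that by (intro tendsto_intros) auto
    then show ?thesis by (simp add: Re_divide power2_eq_square)
  qed
  have "((\<lambda>x. x * Re (1 / (Complex (1 + x) 0 - 1))) \<longlongrightarrow> 1) (at_right 0)"
  proof (rule tendsto_eventually)
    show "\<forall>\<^sub>F x in at_right 0. x * Re (1 / (Complex (1 + x) 0 - 1)) = 1"
      using eventually_at_right_less[of 0] by eventually_elim (simp add: Re_divide power2_eq_square)
  qed
  then have "((\<lambda>x. 3 * (x * Re (1 / (Complex (1 + x) 0 - 1)) - x * Re (deriv zeta_reg (Complex (1 + x) 0) / zeta_reg (Complex (1 + x) 0)))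
     + 4 * (x * Re (1 / (Complex (1 + x) t - 1)) - x * Re (deriv zeta_reg (Complex (1 + x) t) / zeta_reg (Complex (1 + x) t)))
     + (x * Re (1 / (Complex (1 + x) (2 * t) - 1)) - x * Re (deriv zeta_reg (Complex (1 + x) (2 * t)) / zeta_reg (Complex (1 + x) (2 * t)))))
     \<longlongrightarrow> 3 * (1 - real m0) + 4 * (0 - real m1) + (0 - real m2)) (at_right 0)"
    using t by (intro tendsto_intros inv m0 m1 m2) auto
  then have "0 \<le> 3 * (1 - real m0) + 4 * (0 - real m1) + (0 - real m2)"
  proof (rule tendsto_lowerbound)
    show "\<forall>\<^sub>F x in at_right 0. 0 \<le> 3 * (x * Re (1 / (Complex (1 + x) 0 - 1)) - x * Re (deriv zeta_reg (Complex (1 + x) 0) / zeta_reg (Complex (1 + x) 0)))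
     + 4 * (x * Re (1 / (Complex (1 + x) t - 1)) - x * Re (deriv zeta_reg (Complex (1 + x) t) / zeta_reg (Complex (1 + x) t)))
     + (x * Re (1 / (Complex (1 + x) (2 * t) - 1)) - x * Re (deriv zeta_reg (Complex (1 + x) (2 * t)) / zeta_reg (Complex (1 + x) (2 * t))))"
      using eventually_at_right_less[of 0]
    proof eventually_elim
      case (elim x)
      have L: "x * Re (1 / (Complex (1 + x) u - 1)) - x * Re (deriv zeta_reg (Complex (1 + x) u) / zeta_reg (Complex (1 + x) u))
         = x * Re (dirichlet_series mangoldt (Complex (1 + x) u))" for u
      proof -
        have "deriv zeta_reg (Complex (1 + x) u) / zeta_reg (Complex (1 + x) u) = 1 / (Complex (1 + x) u - 1) - dirichlet_series mangoldt (Complex (1 + x) u)"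
          using deriv_zeta_reg_eq[of "Complex (1 + x) u"] zeta_reg_nonzero_Re_gt_1[of "Complex (1 + x) u"] elim
          by simp
        then show ?thesis by (simp only: minus_complex.sel right_diff_distrib)
      qed
      have "0 \<le> x * (3 * Re (dirichlet_series mangoldt (of_real (1 + x))) + 4 * Re (dirichlet_series mangoldt (Complex (1 + x) t))
           + Re (dirichlet_series mangoldt (Complex (1 + x) (2 * t))))"
        using elim by (intro mult_nonneg_nonneg three_four_one_mangoldt) auto
      then show ?case unfolding L by (simp add: algebra_simps complex_of_real_def)
    qed
  qed simp
  with m1(2) show False by simp
qed

lemma zeta_reg_nonzero: "Re z \<ge> 1 \<Longrightarrow> zeta_reg z \<noteq> 0"
  using zeta_reg_nonzero_Re_gt_1 zeta_reg_nonzero_Re_eq_1 by (metis order_le_less)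

section \<open>Newman's Tauberian theorem\<close>

text \<open>
  A Riemann-Lebesgue estimate. On a real segment the exponential has modulus \<open>1\<close>, and one
  integration by parts gains the factor \<open>1 / l\<close>; holomorphy of \<open>F\<close> supplies the bounded derivative.
\<close>

lemma oscillating_segment_integral_bound:
  fixes F :: "complex \<Rightarrow> complex"
  assumes U: "open U" "closed_segment a b \<subseteq> U" and F: "F holomorphic_on U"
    and real: "Im a = 0" "Im b = 0"
  shows "\<exists>C. \<forall>l>0. norm (contour_integral (linepath a b) (\<lambda>w. F w * exp (- \<i> * of_real l * w))) \<le> C / l"
proof -
  let ?S = "closed_segment a b"
  have cF: "continuous_on ?S F" "continuous_on ?S (deriv F)"
    using U F holomorphic_deriv[OF F U(1)]
    by (meson continuous_on_subset holomorphic_on_imp_continuous_on)+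
  have "bounded (F ` ?S)" "bounded (deriv F ` ?S)"
    using cF compact_segment by (blast intro: compact_imp_bounded compact_continuous_image)+
  then obtain M M' where M: "\<And>w. w \<in> ?S \<Longrightarrow> norm (F w) \<le> M" "\<And>w. w \<in> ?S \<Longrightarrow> norm (deriv F w) \<le> M'"
    unfolding bounded_iff by blast
  have M0: "0 \<le> M'" using M(2)[of a] by (smt (verit) ends_in_segment(1) norm_ge_zero)
  have Im0: "Im w = 0" if "w \<in> ?S" for w
    using that real by (auto simp: closed_segment_def)
  have "norm (contour_integral (linepath a b) (\<lambda>w. F w * exp (- \<i> * of_real l * w))) \<le> (2 * M + M' * norm (b - a)) / l"
    if l: "l > 0" for l :: real
  proof -
    let ?E = "\<lambda>w. exp (- \<i> * of_real l * w)"
    have nE: "norm (?E w) = 1" if "w \<in> ?S" for w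
      using Im0[OF that] by simp
    let ?J = "contour_integral (linepath a b) (\<lambda>w. F w * ?E w)"
    let ?J' = "contour_integral (linepath a b) (\<lambda>w. deriv F w * ?E w)"
    have d: "((\<lambda>w. F w * ?E w) has_field_derivative deriv F w * ?E w + (- \<i> * of_real l) * (F w * ?E w)) (at w within U)"
      if "w \<in> U" for w
      using holomorphic_derivI[OF F U(1) that] by (auto intro!: derivative_eq_intros)
    have ftc: "((\<lambda>w. deriv F w * ?E w + (- \<i> * of_real l) * (F w * ?E w)) has_contour_integral
        (F b * ?E b - F a * ?E a)) (linepath a b)"
      using contour_integral_primitive[OF d, of "linepath a b"] U by simp
    have i1: "(\<lambda>w. F w * ?E w) contour_integrable_on linepath a b"
      "(\<lambda>w. deriv F w * ?E w) contour_integrable_on linepath a b"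
      by (intro contour_integrable_continuous_linepath continuous_intros cF)+
    have "((\<lambda>w. deriv F w * ?E w + (- \<i> * of_real l) * (F w * ?E w)) has_contour_integral
        (?J' + (- \<i> * of_real l) * ?J)) (linepath a b)"
      by (intro has_contour_integral_add has_contour_integral_lmul has_contour_integral_integral i1)
    from has_contour_integral_unique[OF this ftc]
    have eq: "\<i> * of_real l * ?J = ?J' + F a * ?E a - F b * ?E b" by (simp add: algebra_simps)
    have "norm ?J' \<le> M' * norm (b - a)"
    proof (intro contour_integral_bound_linepath i1 M0)
      fix w assume "w \<in> closed_segment a b"
      then show "norm (deriv F w * ?E w) \<le> M'" using M(2) nE by (simp only: norm_mult) simp
    qed
    moreover have "norm (F a * ?E a) \<le> M" "norm (F b * ?E b) \<le> M"
      using M(1)[of a] M(1)[of b] nE[of a] nE[of b] by (simp_all only: norm_mult) auto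
    moreover have "norm (?J' + F a * ?E a - F b * ?E b) \<le> norm ?J' + norm (F a * ?E a) + norm (F b * ?E b)"
      by norm
    ultimately have "norm (\<i> * of_real l * ?J) \<le> 2 * M + M' * norm (b - a)"
      unfolding eq by linarith
    then show ?thesis using l by (simp add: norm_mult field_simps)
  qed
  then show ?thesis by blast
qed

text \<open>
  On the circle \<open>1 / w\<close> is \<open>cnj w / R\<^sup>2\<close>, so Newman's kernel is a multiple of \<open>Im w\<close>. This is what
  cancels the factor \<open>1 / Im w\<close> in the bounds on the partial sums.
\<close>

lemma newman_kernel_norm:
  assumes "norm w = R" "R > 0"
  shows "norm (1 / w - w / of_real R ^ 2) = 2 * \<bar>Im w\<bar> / R\<^sup>2"
proof -
  have w0: "w \<noteq> 0" using assms by auto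
  have "w * cnj w = of_real R ^ 2" using assms complex_norm_square[of w] by simp
  then have "1 / w = cnj w / of_real R ^ 2" using w0 assms by (simp add: field_simps)
  then have "1 / w - w / of_real R ^ 2 = (cnj w - w) / of_real R ^ 2" by (simp add: diff_divide_distrib)
  also have "cnj w - w = of_real (-2 * Im w) * \<i>" by (simp add: complex_eq_iff)
  finally show ?thesis by (simp add: norm_mult norm_divide norm_power)
qed

lemma upper_arc_Im: "w \<in> path_image (part_circlepath 0 R 0 pi) \<Longrightarrow> R > 0 \<Longrightarrow> Im w \<ge> 0 \<and> norm w = R"
  by (auto simp: path_image_part_circlepath' closed_segment_eq_real_ivl norm_mult sin_ge_zero)

lemma lower_arc_Im: "w \<in> path_image (part_circlepath 0 R pi (2 * pi)) \<Longrightarrow> R > 0 \<Longrightarrow> Im w \<le> 0 \<and> norm w = R"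
proof (simp add: path_image_part_circlepath' closed_segment_eq_real_ivl, clarsimp simp: norm_mult)
  fix t assume "R > 0" "pi \<le> t" "t \<le> 2 * pi"
  then show "R * sin t \<le> 0"
    using sin_ge_zero[of "t - pi"] by (simp add: mult_nonneg_nonpos sin_diff)
qed

lemma contour_integral_circlepath_halves:
  assumes f: "continuous_on (sphere 0 R) f" and R: "R > 0"
  shows "contour_integral (circlepath 0 R) f =
    contour_integral (part_circlepath 0 R 0 pi) f + contour_integral (part_circlepath 0 R pi (2 * pi)) f"
proof -
  let ?g = "\<lambda>t. f (0 + R * cis t) * R * \<i> * cis t"
  have "continuous_on {0..2*pi} (\<lambda>t. f (0 + of_real R * cis t))"
    by (rule continuous_on_compose2[OF f]) (use R in \<open>auto intro!: continuous_intros simp: norm_mult\<close>)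
  then have "continuous_on {0..2*pi} ?g" by (intro continuous_intros) auto
  then have "?g integrable_on {0..2*pi}" by (rule integrable_continuous_real)
  then have "integral {0..2*pi} ?g = integral {0..pi} ?g + integral {pi..2*pi} ?g"
    by (intro Henstock_Kurzweil_Integration.integral_combine[symmetric]) auto
  then show ?thesis
    by (simp add: circlepath_def contour_integral_part_circlepath_eq)
qed

lemma mult_exp_minus_le:
  fixes y l :: real
  assumes "y \<ge> 0" "l > 0"
  shows "y * exp (- l * y) \<le> 1 / l"
proof -
  have "l * y \<le> exp (l * y)" using exp_ge_add_one_self[of "l*y"] by linarith
  then have "l * y * exp (- (l * y)) \<le> exp (l*y) * exp (-(l*y))" by (intro mult_right_mono) auto
  also have "\<dots> = 1" by (simp flip: exp_add)
  finally show ?thesis using assms by (simp add: field_simps)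
qed

text \<open>
  Here the half-plane of convergence is \<open>Im w > 0\<close>, which puts the boundary on the real axis and
  makes the two half circles arcs with angles in \<open>[0, \<pi>]\<close> and \<open>[\<pi>, 2 \<pi>]\<close>.

  Cauchy's formula for \<open>P w - G 0\<close> over the whole circle is split into four integrals. On the
  upper arc \<open>P - G\<close> and on the lower arc \<open>P\<close> contribute at most \<open>2 B / R\<close> together, since the kernel
  cancels the given bounds. The constant \<open>G 0\<close> on the lower arc contributes \<open>O(1 / l)\<close>, as
  \<open>y exp (- l y) \<le> 1 / l\<close>. On the upper arc \<open>G w - G 0\<close> has the factor \<open>w\<close>, which removes the pole of
  the kernel; so the path can be moved to the real segment, where the integral oscillates. Thus the
  subtraction of \<open>G 0\<close> keeps every path for \<open>G\<close> inside the closed half-plane.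

  The constant \<open>C\<close> must not depend on \<open>P\<close> and \<open>l\<close>, as the estimate is used with \<open>l\<close> tending to infinity.
\<close>

lemma newman_circle_estimate:
  fixes G :: "complex \<Rightarrow> complex"
  assumes U: "open U" "{w. Im w \<ge> 0} \<subseteq> U" and G: "G holomorphic_on U" and R: "R > 0" and B: "B \<ge> 0"
  shows "\<exists>C. \<forall>P l. P holomorphic_on UNIV \<longrightarrow> l > 0 \<longrightarrow>
      (\<forall>w. Im w > 0 \<longrightarrow> norm (P w - G w) \<le> B * exp (- l * Im w) / Im w) \<longrightarrow>
      (\<forall>w. Im w < 0 \<longrightarrow> norm (P w) \<le> B * exp (- l * Im w) / (- Im w)) \<longrightarrow>
      norm (P 0 - G 0) \<le> 2 * B / R + C / l"
proof -
  define q where "q = (\<lambda>w. if w = 0 then deriv G 0 else (G w - G 0) / (w - 0))"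
  have q: "q holomorphic_on U" unfolding q_def by (rule pole_lemma_open[OF G U(1)])
  define F where "F = (\<lambda>w. q w * (1 - w\<^sup>2 / of_real R ^ 2))"
  have F: "F holomorphic_on U" unfolding F_def using R by (intro holomorphic_intros q) auto
  have seg: "closed_segment (of_real (-R)) (of_real R) \<subseteq> {w. Im w \<ge> 0}"
    by (auto simp: closed_segment_def)
  obtain C where C: "\<And>l. l > 0 \<Longrightarrow> norm (contour_integral (linepath (of_real (-R)) (of_real R)) (\<lambda>w. F w * exp (- \<i> * of_real l * w))) \<le> C / l"
    using oscillating_segment_integral_bound[OF U(1) _ F, of "of_real (-R)" "of_real R"] seg U(2) by auto
  define D where "D = (C + norm (G 0) * 2 * pi / R) / (2 * pi)"
  show ?thesis
  proof (intro exI[of _ D] allI impI)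
    fix P l
    assume P: "P holomorphic_on UNIV" and l: "l > (0::real)"
      and up: "\<forall>w. Im w > 0 \<longrightarrow> norm (P w - G w) \<le> B * exp (- l * Im w) / Im w"
      and lo: "\<forall>w. Im w < 0 \<longrightarrow> norm (P w) \<le> B * exp (- l * Im w) / (- Im w)"
    let ?E = "\<lambda>w. exp (- \<i> * of_real l * w)"
    let ?K = "\<lambda>w. ?E w * (1 / w - w / of_real R ^ 2)"
    let ?up = "part_circlepath 0 R 0 pi" and ?lo = "part_circlepath 0 R pi (2 * pi)"
    have nK: "norm (?K w) = exp (l * Im w) * (2 * \<bar>Im w\<bar> / R\<^sup>2)" if "norm w = R" for w
      using newman_kernel_norm[OF that R] by (simp add: norm_mult)
    have wne: "w \<noteq> 0" if "norm w = R" for w :: complex using that R by auto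
    have contP: "continuous_on S P" for S using P holomorphic_on_imp_continuous_on continuous_on_subset by blast
    have contG: "continuous_on (path_image ?up) G"
    proof (rule continuous_on_subset[OF holomorphic_on_imp_continuous_on[OF G]])
      show "path_image ?up \<subseteq> U" using U(2) upper_arc_Im[OF _ R] by blast
    qed
    have contK: "continuous_on S ?K" if "S \<subseteq> sphere 0 R" for S
    proof -
      have "w \<noteq> 0" if "w \<in> S" for w using that \<open>S \<subseteq> sphere 0 R\<close> R by auto
      then have "continuous_on S (\<lambda>w. 1 / w)" by (intro continuous_on_divide continuous_on_const continuous_on_id) auto
      moreover have "continuous_on S (\<lambda>w. w / of_real R ^ 2)" using R by (intro continuous_on_divide continuous_on_const continuous_on_id) auto
      moreover have "continuous_on S ?E" by (intro continuous_on_exp continuous_on_mult continuous_on_const continuous_on_id)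
      ultimately show ?thesis by (intro continuous_on_mult continuous_on_diff)
    qed
    have contmul: "continuous_on S (\<lambda>w. f w * ?K w)" if "continuous_on S f" "S \<subseteq> sphere 0 R" for S f
      by (rule continuous_on_mult[OF that(1) contK[OF that(2)]])
    have kpos: "0 \<le> exp (l * Im w) * (2 * \<bar>Im w\<bar> / R\<^sup>2)" for w by simp
    have sub: "path_image ?up \<subseteq> sphere 0 R" "path_image ?lo \<subseteq> sphere 0 R"
      using upper_arc_Im lower_arc_Im R by fastforce+
    have "((\<lambda>w. (P w - G 0) * ?E w * (1 - w\<^sup>2 / of_real R ^ 2) / (w - 0)) has_contour_integral
        (2 * of_real pi * \<i> * ((P 0 - G 0) * ?E 0 * (1 - 0\<^sup>2 / of_real R ^ 2)))) (circlepath 0 R)"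
      using R by (intro Cauchy_integral_circlepath_simple holomorphic_intros holomorphic_on_subset[OF P]) auto
    then have cauchy: "contour_integral (circlepath 0 R) (\<lambda>w. (P w - G 0) * ?E w * (1 - w\<^sup>2 / of_real R ^ 2) / (w - 0)) = 2 * of_real pi * \<i> * (P 0 - G 0)"
      by (simp add: contour_integral_unique)
    have "contour_integral (circlepath 0 R) (\<lambda>w. (P w - G 0) * ?K w) =
       contour_integral (circlepath 0 R) (\<lambda>w. (P w - G 0) * ?E w * (1 - w\<^sup>2 / of_real R ^ 2) / (w - 0))"
      by (rule contour_integral_cong) (use wne R in \<open>auto simp: field_simps power2_eq_square\<close>)
    also note cauchy
    also have "contour_integral (circlepath 0 R) (\<lambda>w. (P w - G 0) * ?K w) =
        contour_integral ?up (\<lambda>w. (P w - G 0) * ?K w) + contour_integral ?lo (\<lambda>w. (P w - G 0) * ?K w)"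
      by (intro contour_integral_circlepath_halves contmul continuous_on_diff contP continuous_on_const R) auto
    also have "contour_integral ?up (\<lambda>w. (P w - G 0) * ?K w) =
        contour_integral ?up (\<lambda>w. (P w - G w) * ?K w + (G w - G 0) * ?K w)"
      unfolding distrib_right[symmetric] by simp
    also have "\<dots> = contour_integral ?up (\<lambda>w. (P w - G w) * ?K w) + contour_integral ?up (\<lambda>w. (G w - G 0) * ?K w)"
      by (intro contour_integral_add contour_integrable_continuous_part_circlepath contmul continuous_on_diff contP contG sub continuous_on_const)
    also have "contour_integral ?lo (\<lambda>w. (P w - G 0) * ?K w) = contour_integral ?lo (\<lambda>w. P w * ?K w - G 0 * ?K w)"
      unfolding left_diff_distrib[symmetric] ..
    also have "\<dots> = contour_integral ?lo (\<lambda>w. P w * ?K w) - contour_integral ?lo (\<lambda>w. G 0 * ?K w)"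
      by (intro contour_integral_diff contour_integrable_continuous_part_circlepath contmul contP sub continuous_on_const)
    finally have eq: "contour_integral ?up (\<lambda>w. (P w - G w) * ?K w) + contour_integral ?up (\<lambda>w. (G w - G 0) * ?K w)
       + (contour_integral ?lo (\<lambda>w. P w * ?K w) - contour_integral ?lo (\<lambda>w. G 0 * ?K w)) = 2 * of_real pi * \<i> * (P 0 - G 0)" .
    have I1: "norm (contour_integral ?up (\<lambda>w. (P w - G w) * ?K w)) \<le> (2 * B / R\<^sup>2) * R * \<bar>pi - 0\<bar>"
    proof (intro contour_integral_bound_part_circlepath contour_integrable_continuous_part_circlepath contmul continuous_on_diff contP contG sub)
      fix w assume "w \<in> path_image ?up"
      then have w: "Im w \<ge> 0" "norm w = R" using upper_arc_Im R by auto
      show "norm ((P w - G w) * ?K w) \<le> 2 * B / R\<^sup>2"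
      proof (cases "Im w = 0")
        case False
        then have y: "Im w > 0" using w by simp
        have "norm ((P w - G w) * ?K w) \<le> (B * exp (- l * Im w) / Im w) * (exp (l * Im w) * (2 * \<bar>Im w\<bar> / R\<^sup>2))"
          unfolding norm_mult[of "P w - G w"] nK[OF w(2)] by (rule mult_right_mono[OF up[rule_format, OF y]]) (rule kpos)
        also have "\<dots> = 2 * B / R\<^sup>2 * (exp (- l * Im w) * exp (l * Im w))" using y R by (simp add: field_simps)
        also have "\<dots> = 2 * B / R\<^sup>2" by (simp flip: exp_add)
        finally show ?thesis .
      qed (use B in \<open>simp only: norm_mult[of "P w - G w"] nK[OF w(2)], simp\<close>)
    qed (use B R in auto)
    have I3: "norm (contour_integral ?lo (\<lambda>w. P w * ?K w)) \<le> (2 * B / R\<^sup>2) * R * \<bar>2 * pi - pi\<bar>"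
    proof (intro contour_integral_bound_part_circlepath contour_integrable_continuous_part_circlepath contmul contP sub)
      fix w assume "w \<in> path_image ?lo"
      then have w: "Im w \<le> 0" "norm w = R" using lower_arc_Im R by auto
      show "norm (P w * ?K w) \<le> 2 * B / R\<^sup>2"
      proof (cases "Im w = 0")
        case False
        then have y: "Im w < 0" using w by simp
        have "norm (P w * ?K w) \<le> (B * exp (- l * Im w) / (- Im w)) * (exp (l * Im w) * (2 * \<bar>Im w\<bar> / R\<^sup>2))"
          unfolding norm_mult[of "P w"] nK[OF w(2)] by (rule mult_right_mono[OF lo[rule_format, OF y]]) (rule kpos)
        also have "\<dots> = 2 * B / R\<^sup>2 * (exp (- l * Im w) * exp (l * Im w))" using y R by (simp add: field_simps)
        also have "\<dots> = 2 * B / R\<^sup>2" by (simp flip: exp_add)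
        finally show ?thesis .
      qed (use B in \<open>simp only: norm_mult[of "P w"] nK[OF w(2)], simp\<close>)
    qed (use B R in auto)
    have I4: "norm (contour_integral ?lo (\<lambda>w. G 0 * ?K w)) \<le> (norm (G 0) * (2 / (l * R\<^sup>2))) * R * \<bar>2 * pi - pi\<bar>"
    proof (intro contour_integral_bound_part_circlepath contour_integrable_continuous_part_circlepath contmul continuous_on_const sub)
      fix w assume "w \<in> path_image ?lo"
      then have w: "Im w \<le> 0" "norm w = R" using lower_arc_Im R by auto
      have "(- Im w) * exp (- l * (- Im w)) \<le> 1 / l" using w l by (intro mult_exp_minus_le) auto
      then have "(- Im w) * exp (l * Im w) * (2 / R\<^sup>2) \<le> 1 / l * (2 / R\<^sup>2)" by (intro mult_right_mono) auto
      then have "norm (?K w) \<le> 2 / (l * R\<^sup>2)" unfolding nK[OF w(2)] using w by (simp add: field_simps)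
      then show "norm (G 0 * ?K w) \<le> norm (G 0) * (2 / (l * R\<^sup>2))"
        by (simp only: norm_mult[of "G 0"] mult_left_mono norm_ge_zero)
    qed (use l R in auto)
    have I2: "norm (contour_integral ?up (\<lambda>w. (G w - G 0) * ?K w)) \<le> C / l"
    proof -
      have cong: "contour_integral ?up (\<lambda>w. (G w - G 0) * ?K w) = contour_integral ?up (\<lambda>w. F w * ?E w)"
        by (rule contour_integral_cong)
          (use wne upper_arc_Im R in \<open>auto simp: F_def q_def field_simps power2_eq_square\<close>)
      let ?seg = "linepath (of_real (-R)) (of_real R) :: real \<Rightarrow> complex"
      have hol: "(\<lambda>w. F w * ?E w) holomorphic_on {w. Im w \<ge> 0}"
        using F U(2) by (intro holomorphic_intros) (auto intro: holomorphic_on_subset)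
      have "((\<lambda>w. F w * ?E w) has_contour_integral 0) (?up +++ ?seg)"
      proof (rule Cauchy_theorem_convex_simple[OF hol convex_halfspace_Im_ge])
        show "path_image (?up +++ ?seg) \<subseteq> {w. Im w \<ge> 0}"
          using seg upper_arc_Im[of _ R] R by (subst path_image_join) auto
      qed (auto intro!: valid_path_join)
      moreover have join: "((\<lambda>w. F w * ?E w) has_contour_integral
          (contour_integral ?up (\<lambda>w. F w * ?E w) + contour_integral ?seg (\<lambda>w. F w * ?E w))) (?up +++ ?seg)"
        using holomorphic_on_imp_continuous_on[OF hol] seg upper_arc_Im[of _ R] R
        by (intro has_contour_integral_join has_contour_integral_integral
            contour_integrable_continuous_part_circlepath contour_integrable_continuous_linepath)
          (blast intro: continuous_on_subset valid_path_part_circlepath valid_path_linepath)+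
      ultimately have "contour_integral ?up (\<lambda>w. F w * ?E w) = - contour_integral ?seg (\<lambda>w. F w * ?E w)"
        using has_contour_integral_unique[OF _ join] by (simp only: eq_neg_iff_add_eq_0)
      then show ?thesis using C[OF l] cong by simp
    qed
    have tri: "norm (a + b + (c - d)) \<le> norm a + norm b + norm c + norm d" for a b c d :: complex
      by (smt (verit) norm_triangle_ineq norm_triangle_ineq4)
    have "2 * pi * norm (P 0 - G 0) = norm (2 * of_real pi * \<i> * (P 0 - G 0))" by (simp add: norm_mult)
    also have "\<dots> \<le> (2 * B / R\<^sup>2) * R * \<bar>pi - 0\<bar> + C / l + (2 * B / R\<^sup>2) * R * \<bar>2 * pi - pi\<bar> + (norm (G 0) * (2 / (l * R\<^sup>2))) * R * \<bar>2 * pi - pi\<bar>"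
      unfolding eq[symmetric] by (rule order_trans[OF tri]) (intro add_mono I1 I2 I3 I4)
    also have "\<dots> = 2 * pi * (2 * B / R + D / l)"
      using R l by (simp add: D_def field_simps power2_eq_square)
    finally show "norm (P 0 - G 0) \<le> 2 * B / R + D / l" by simp
  qed
qed

text \<open>
  Newman's theorem for a sequence of entire approximations with cutoffs \<open>l n\<close>: fix a radius \<open>R\<close> that
  makes \<open>2 B / R\<close> small, then let \<open>l n\<close> tend to infinity.
\<close>

theorem newman_tauberian:
  fixes G :: "complex \<Rightarrow> complex" and P :: "nat \<Rightarrow> complex \<Rightarrow> complex" and l :: "nat \<Rightarrow> real"
  assumes U: "open U" "{w. Im w \<ge> 0} \<subseteq> U" and G: "G holomorphic_on U"
    and P: "\<And>n. P n holomorphic_on UNIV" and l: "filterlim l at_top sequentially"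
    and up: "\<And>n w. Im w > 0 \<Longrightarrow> norm (P n w - G w) \<le> B * exp (- l n * Im w) / Im w"
    and lo: "\<And>n w. Im w < 0 \<Longrightarrow> norm (P n w) \<le> B * exp (- l n * Im w) / (- Im w)"
  shows "(\<lambda>n. P n 0) \<longlonglongrightarrow> G 0"
proof (rule metric_LIMSEQ_I)
  fix e :: real assume e: "e > 0"
  have B: "B \<ge> 0" 
  proof -
    have "0 \<le> B * exp (- l 0 * Im \<i>) / Im \<i>" using up[of \<i> 0] by (smt (verit) norm_ge_zero imaginary_unit.sel(2))
    then show ?thesis by (simp add: zero_le_mult_iff)
  qed
  \<comment> \<open>The two arcs contribute \<open>2 B / R\<close>, which drops below \<open>e / 2\<close>; the summand \<open>1\<close> keeps \<open>R\<close> positive when \<open>B = 0\<close>.\<close>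
  define R where "R = 4 * (B + 1) / e"
  have R: "R > 0" "2 * B / R < e / 2" using B e by (auto simp: R_def field_simps add_pos_nonneg)
  obtain C where C: "\<And>P l. P holomorphic_on UNIV \<Longrightarrow> l > 0 \<Longrightarrow>
      (\<forall>w. Im w > 0 \<longrightarrow> norm (P w - G w) \<le> B * exp (- l * Im w) / Im w) \<Longrightarrow>
      (\<forall>w. Im w < 0 \<longrightarrow> norm (P w) \<le> B * exp (- l * Im w) / (- Im w)) \<Longrightarrow>
      norm (P 0 - G 0) \<le> 2 * B / R + C / l"
    using newman_circle_estimate[OF U G R(1) B] by blast
  have "((\<lambda>n. C / l n) \<longlongrightarrow> 0) sequentially"
    by (rule tendsto_divide_0[OF tendsto_const]) (use l in \<open>rule filterlim_at_top_imp_at_infinity\<close>)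
  then have "\<forall>\<^sub>F n in sequentially. C / l n < e / 2"
    using e by (intro order_tendstoD(2)) auto
  moreover have "\<forall>\<^sub>F n in sequentially. l n > 0"
    using l by (simp add: filterlim_at_top_dense)
  ultimately have "\<forall>\<^sub>F n in sequentially. dist (P n 0) (G 0) < e"
  proof eventually_elim
    case (elim n)
    have "norm (P n 0 - G 0) \<le> 2 * B / R + C / l n"
      using elim P up lo by (intro C) auto
    then show ?case unfolding dist_norm using elim R by linarith
  qed
  then show "\<exists>N. \<forall>n\<ge>N. dist (P n 0) (G 0) < e" by (simp add: eventually_sequentially)
qed

section \<open>Convergence at the boundary point\<close>

lemma summation_by_parts:
  fixes c u :: "nat \<Rightarrow> complex"
  shows "(\<Sum>n<N. (\<Sum>i\<le>n. c i) * (u n - u (Suc n))) = (\<Sum>n<N. c n * u n) - (\<Sum>i<N. c i) * u N"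
  by (induction N) (simp_all add: algebra_simps lessThan_Suc_atMost[symmetric])

lemma psi_diff_le: "\<bar>psi n - real n\<bar> \<le> 4 * real n"
  using psi_le[of n] psi_nonneg[of n] by (simp add: abs_if)

lemma psi_diff_eq_sum: "psi n - real n = (\<Sum>i<n. mangoldt (Suc i) - 1)"
  by (induction n) (simp_all add: psi_Suc)

text \<open>
  The sum of \<open>A(n)\<close> times these gaps is what summation by parts makes of the Dirichlet series with
  summatory function \<open>A\<close>.
\<close>

definition powr_gap :: "nat \<Rightarrow> complex \<Rightarrow> complex" where
  "powr_gap n s = of_nat (Suc n) powr (- s) - of_nat (Suc (Suc n)) powr (- s)"

text \<open>
  The integral of \<open>u\<^bsup>-s-1\<^esup>\<close> over \<open>[n + 1, n + 2]\<close>, as an entire function of \<open>s\<close>. The value at \<open>0\<close>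
  fills the removable singularity; it is needed because the circle in \<open>newman_circle_estimate\<close>
  may enclose that point.
\<close>

definition gap_kernel :: "nat \<Rightarrow> complex \<Rightarrow> complex" where
  "gap_kernel n s = (if s = 0 then deriv (powr_gap n) 0 else (powr_gap n s - powr_gap n 0) / (s - 0))"

lemma powr_gap_0 [simp]: "powr_gap n 0 = 0"
  by (simp add: powr_gap_def del: of_nat_Suc)

lemma gap_kernel_nonzero: "s \<noteq> 0 \<Longrightarrow> gap_kernel n s = powr_gap n s / s"
  by (simp add: gap_kernel_def)

lemma holomorphic_gap_kernel: "gap_kernel n holomorphic_on UNIV"
  unfolding gap_kernel_def[abs_def]
  by (rule pole_lemma_open) (auto simp: powr_gap_def[abs_def] intro!: holomorphic_intros)

lemma gap_kernel_0: "gap_kernel n 0 = of_real (ln (real (Suc (Suc n))) - ln (real (Suc n)))"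
proof -
  have d: "((\<lambda>x. of_nat (Suc m) powr (- x) :: complex) has_field_derivative
      (Ln (of_nat (Suc m)) * of_nat (Suc m) powr (- 0)) * (- 1)) (at 0)" for m
    by (rule DERIV_chain2[OF has_field_derivative_powr_right])
      (auto intro!: derivative_eq_intros simp del: of_nat_Suc)
  have "deriv (powr_gap n) 0 = (Ln (of_nat (Suc n)) * of_nat (Suc n) powr (- 0)) * (- 1) - (Ln (of_nat (Suc (Suc n))) * of_nat (Suc (Suc n)) powr (- 0)) * (- 1)"
    unfolding powr_gap_def[abs_def] by (intro DERIV_imp_deriv DERIV_diff d)
  then show ?thesis by (simp add: gap_kernel_def Ln_of_nat del: of_nat_Suc)
qed

text \<open>
  For \<open>Re s = 1 + x\<close> the integrand, multiplied by \<open>n + 1 \<le> u\<close>, is at most \<open>u\<^bsup>-x-1\<^esup>\<close>, whose integral is the right-hand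
  side. As that is a telescoping difference, the sums over \<open>n\<close> will be exactly of
  the shape \<open>newman_tauberian\<close> asks for, for either sign of \<open>x\<close>.
\<close>

lemma norm_gap_kernel_le:
  assumes x: "x \<noteq> 0" and s: "Re s = 1 + x"
  shows "real (Suc n) * norm (gap_kernel n s) \<le> (real (Suc n) powr (- x) - real (Suc (Suc n)) powr (- x)) / x"
proof (cases "s = 0")
  case True
  then have [simp]: "x = -1" using s by simp
  have "ln (real (Suc (Suc n))) - ln (real (Suc n)) = ln (1 + 1 / real (Suc n))"
  proof -
    have "1 + 1 / real (Suc n) = real (Suc (Suc n)) / real (Suc n)" by (simp add: field_simps)
    then show ?thesis by (simp add: ln_div del: of_nat_Suc)
  qed
  then have "norm (gap_kernel n s) \<le> 1 / real (Suc n)"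
    using ln_add_one_self_le_self[of "1 / real (Suc n)"] ln_ge_zero[of "1 + 1 / real (Suc n)"] True
    by (simp only: gap_kernel_0 norm_of_real) simp
  then show ?thesis by (simp add: field_simps)
next
  case False
  let ?m = "real (Suc n)"
  let ?f = "\<lambda>u::real. of_real ?m * of_real u powr (- s) :: complex"
  let ?g = "\<lambda>u::real. - (norm s * u powr (- x) / x)"
  have "norm (?f (?m + 1) - ?f ?m) \<le> ?g (?m + 1) - ?g ?m"
  proof (rule differentiable_bound_general)
    show "?m < ?m + 1" by simp
    have d: "(?f has_vector_derivative (of_real ?m * (- s * of_real u powr (- s - 1)))) (at u)" if "u > 0" for u
    proof -
      have "((\<lambda>z. z powr (- s)) has_field_derivative (- s * of_real u powr (- s - 1))) (at (of_real u))"
        using that by (intro has_field_derivative_powr) (auto simp: complex_nonpos_Reals_iff)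
      then have "((\<lambda>z. of_real ?m * z powr (- s)) has_field_derivative (of_real ?m * (- s * of_real u powr (- s - 1)))) (at (of_real u))"
        by (rule DERIV_cmult)
      then show ?thesis by (rule has_vector_derivative_real_field)
    qed
    have dg: "(?g has_vector_derivative (norm s * u powr (- x - 1))) (at u)" if "u > 0" for u
      using that x by (auto intro!: derivative_eq_intros simp: has_real_derivative_iff_has_vector_derivative[symmetric])
    show "continuous_on {?m..?m + 1} ?f"
      by (intro continuous_at_imp_continuous_on ballI has_vector_derivative_continuous[OF d]) auto
    show "continuous_on {?m..?m + 1} ?g"
      by (intro continuous_at_imp_continuous_on ballI has_vector_derivative_continuous[OF dg]) auto
    fix u assume u: "?m < u" "u < ?m + 1"
    show "(?f has_vector_derivative (of_real ?m * (- s * of_real u powr (- s - 1)))) (at u)" using d u by simp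
    show "(?g has_vector_derivative (norm s * u powr (- x - 1))) (at u)" using dg u by simp
    have "norm (of_real ?m * (- s * of_real u powr (- s - 1)) :: complex) = ?m * (norm s * u powr (- x - 2))"
      using u s by (simp add: norm_mult norm_powr_real_powr algebra_simps del: of_nat_Suc)
    also have "\<dots> \<le> u * (norm s * u powr (- x - 2))" using u by (intro mult_right_mono) auto
    also have "\<dots> = norm s * u powr (- x - 1)"
    proof -
      have "u powr (- x - 1) = u powr (1 + (- x - 2))" by (rule arg_cong[of _ _ "(powr) u"]) simp
      also have "\<dots> = u * u powr (- x - 2)" using u unfolding powr_add by simp
      finally show ?thesis by simp
    qed
    finally show "norm (of_real ?m * (- s * of_real u powr (- s - 1)) :: complex) \<le> norm s * u powr (- x - 1)" .
  qed
  also have "?f (?m + 1) - ?f ?m = - (of_real ?m * powr_gap n s)"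
    by (simp add: powr_gap_def algebra_simps)
  also have "?g (?m + 1) - ?g ?m = norm s * ((?m powr (- x) - (?m + 1) powr (- x)) / x)"
    by (simp add: diff_divide_distrib algebra_simps)
  finally have "?m * norm (powr_gap n s) \<le> norm s * ((?m powr (- x) - (?m + 1) powr (- x)) / x)"
    unfolding norm_minus_cancel norm_mult norm_of_real by simp
  then have "?m * norm (powr_gap n s) / norm s \<le> (?m powr (- x) - (?m + 1) powr (- x)) / x"
    using False by (simp add: field_simps)
  then show ?thesis using False by (simp add: gap_kernel_nonzero norm_divide add_ac)
qed

text \<open>
  The integral of \<open>(\<psi>(u) - \<lfloor>u\<rfloor>) u\<^bsup>-s-1\<^esup>\<close> over \<open>[n + 1, n + 2]\<close>, with \<open>\<psi>\<close> constant between integers.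
\<close>

definition psi_kernel_term :: "nat \<Rightarrow> complex \<Rightarrow> complex" where
  "psi_kernel_term n s = of_real (psi (Suc n) - real (Suc n)) * gap_kernel n s"

lemma norm_psi_kernel_term_le:
  assumes x: "x \<noteq> 0" and s: "Re s = 1 + x"
  shows "norm (psi_kernel_term n s) \<le> 4 * (real (Suc n) powr (- x) / x - real (Suc (Suc n)) powr (- x) / x)"
proof -
  have "norm (psi_kernel_term n s) \<le> (4 * real (Suc n)) * norm (gap_kernel n s)"
    unfolding psi_kernel_term_def norm_mult norm_of_real by (intro mult_right_mono psi_diff_le) auto
  also have "\<dots> \<le> 4 * ((real (Suc n) powr (- x) - real (Suc (Suc n)) powr (- x)) / x)"
    unfolding mult.assoc by (intro mult_left_mono norm_gap_kernel_le[OF x s]) auto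
  finally show ?thesis unfolding diff_divide_distrib .
qed

lemma tail_psi_kernel:
  assumes x: "x > 0" and s: "Re s = 1 + x"
  shows "summable (\<lambda>n. psi_kernel_term n s)"
    "norm (\<Sum>n. psi_kernel_term (n + N) s) \<le> 4 * (real (Suc N) powr (- x) / x)"
proof -
  let ?h = "\<lambda>n. real (Suc n) powr (- x) / x"
  have "(\<lambda>n. real (Suc n) powr (- x) / x) \<longlonglongrightarrow> 0 / x"
    using x by (intro tendsto_divide tendsto_neg_powr filterlim_compose[OF filterlim_real_sequentially filterlim_Suc]) auto
  then have h0: "?h \<longlonglongrightarrow> 0" by simp
  have tele: "(\<lambda>n. 4 * (?h (n + M) - ?h (Suc (n + M)))) sums (4 * (?h M - 0))" for M
  proof (intro sums_mult)
    show "(\<lambda>n. ?h (n + M) - ?h (Suc (n + M))) sums (?h M - 0)"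
      using telescope_sums'[OF LIMSEQ_ignore_initial_segment[OF h0, of M]] by simp
  qed
  have le: "norm (psi_kernel_term (n + M) s) \<le> 4 * (?h (n + M) - ?h (Suc (n + M)))" for n M
    using norm_psi_kernel_term_le[OF _ s, of "n + M"] x by simp
  \<comment> \<open>\<open>M = 0\<close> gives summability, \<open>M = N\<close> the bound on the tail.\<close>
  have "summable (\<lambda>n. norm (psi_kernel_term (n + M) s))" for M
    by (rule summable_comparison_test'[OF sums_summable[OF tele[of M]], of 0]) (use le in auto)
  from this[of 0] this[of N] show "summable (\<lambda>n. psi_kernel_term n s)"
    "norm (\<Sum>n. psi_kernel_term (n + N) s) \<le> 4 * (real (Suc N) powr (- x) / x)"
  proof -
    assume 0: "summable (\<lambda>n. norm (psi_kernel_term (n + 0) s))" and N: "summable (\<lambda>n. norm (psi_kernel_term (n + N) s))"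
    show "summable (\<lambda>n. psi_kernel_term n s)" using summable_norm_cancel[OF 0] by simp
    have "norm (\<Sum>n. psi_kernel_term (n + N) s) \<le> (\<Sum>n. norm (psi_kernel_term (n + N) s))"
      by (rule summable_norm[OF N])
    also have "\<dots> \<le> (\<Sum>n. 4 * (?h (n + N) - ?h (Suc (n + N))))"
      by (intro suminf_le le N sums_summable[OF tele])
    also have "\<dots> = 4 * ?h N" using sums_unique[OF tele[of N]] by simp
    finally show "norm (\<Sum>n. psi_kernel_term (n + N) s) \<le> 4 * ?h N" .
  qed
qed

lemma head_psi_kernel:
  assumes x: "x < 0" and s: "Re s = 1 + x"
  shows "norm (\<Sum>n<N. psi_kernel_term n s) \<le> 4 * (real (Suc N) powr (- x) / (- x))"
proof -
  let ?h = "\<lambda>n. real (Suc n) powr (- x) / x"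
  have "norm (\<Sum>n<N. psi_kernel_term n s) \<le> (\<Sum>n<N. 4 * (?h n - ?h (Suc n)))"
    using x by (intro sum_norm_le norm_psi_kernel_term_le s) auto
  also have "\<dots> = 4 * (?h 0 - ?h N)"
    using sum_lessThan_telescope'[of ?h N] by (simp only: sum_distrib_left[symmetric])
  also have "\<dots> \<le> 4 * (real (Suc N) powr (- x) / (- x))" using x by (simp add: field_simps)
  finally show ?thesis .
qed

text \<open>
  Summation by parts with the coefficients \<open>\<Lambda>(n) - 1\<close>, whose summatory function is \<open>\<psi>(n) - n\<close>. The
  boundary term vanishes in the limit because \<open>\<psi>(n) - n = O(n)\<close> and \<open>Re s > 1\<close>.
\<close>

lemma psi_kernel_sum_eq:
  assumes s: "Re s > 1"
  shows "(\<Sum>n. psi_kernel_term n s) = (dirichlet_series mangoldt s - zeta_series s) / s"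
proof -
  have s0: "s \<noteq> 0" using s by auto
  let ?u = "\<lambda>n. of_nat (Suc n) powr (- s) :: complex"
  let ?c = "\<lambda>n. of_real (mangoldt (Suc n) - 1) :: complex"
  have A: "(\<Sum>i<n. ?c i) = of_real (psi n - real n)" for n
    by (simp only: psi_diff_eq_sum of_real_sum)
  have eq: "(\<Sum>n<N. psi_kernel_term n s) = ((\<Sum>n<N. ?c n * ?u n) - of_real (psi N - real N) * ?u N) / s" for N
  proof -
    have "(\<Sum>n<N. psi_kernel_term n s) = (\<Sum>n<N. (\<Sum>i\<le>n. ?c i) * (?u n - ?u (Suc n))) / s"
      unfolding sum_divide_distrib lessThan_Suc_atMost[symmetric] A
      by (simp add: psi_kernel_term_def gap_kernel_nonzero[OF s0] powr_gap_def)
    then show ?thesis using summation_by_parts[of ?c ?u N] by (simp only: A)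
  qed
  have "(\<lambda>n. of_real (mangoldt (Suc n)) * ?u n) sums dirichlet_series mangoldt s"
    unfolding dirichlet_series_def by (rule summable_sums[OF summable_norm_cancel[OF abs_summable_dirichlet_series[OF mangoldt_coeff_bound s]]])
  moreover have "(\<lambda>n. of_real 1 * ?u n) sums zeta_series s"
    unfolding dirichlet_series_def by (rule summable_sums[OF summable_norm_cancel[OF abs_summable_dirichlet_series[OF one_coeff_bound s]]])
  ultimately have "(\<lambda>n. of_real (mangoldt (Suc n)) * ?u n - of_real 1 * ?u n) sums (dirichlet_series mangoldt s - zeta_series s)"
    by (rule sums_diff)
  then have lim1: "(\<lambda>N. \<Sum>n<N. ?c n * ?u n) \<longlonglongrightarrow> dirichlet_series mangoldt s - zeta_series s"
    by (simp add: sums_def algebra_simps)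
  have lim2: "(\<lambda>N. of_real (psi N - real N) * ?u N) \<longlonglongrightarrow> 0"
  proof (rule Lim_null_comparison)
    show "\<forall>\<^sub>F N in sequentially. norm (of_real (psi N - real N) * ?u N) \<le> 4 * norm (of_nat (Suc N) powr (1 - s) :: complex)"
    proof (intro always_eventually allI)
      fix N
      have "norm (of_real (psi N - real N) * ?u N) \<le> (4 * real (Suc N)) * real (Suc N) powr (- Re s)"
        unfolding norm_mult norm_Suc_powr norm_of_real using psi_diff_le[of N] by (intro mult_mono) auto
      also have "\<dots> = 4 * norm (of_nat (Suc N) powr (1 - s) :: complex)"
        unfolding norm_Suc_powr using powr_add[of "real (Suc N)" 1 "- Re s"] by simp
      finally show "norm (of_real (psi N - real N) * ?u N) \<le> 4 * norm (of_nat (Suc N) powr (1 - s) :: complex)" .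
    qed
    show "(\<lambda>N. 4 * norm (of_nat (Suc N) powr (1 - s) :: complex)) \<longlonglongrightarrow> 0"
      using s by (intro tendsto_mult_right_zero tendsto_norm_zero Suc_powr_tendsto_0) auto
  qed
  have "(\<lambda>N. \<Sum>n<N. psi_kernel_term n s) \<longlonglongrightarrow> (dirichlet_series mangoldt s - zeta_series s - 0) / s"
    unfolding eq using s0 by (intro tendsto_intros lim1 lim2) auto
  then show ?thesis by (simp add: sums_def[symmetric] sums_iff)
qed

text \<open>
  With \<open>s = 1 - \<i> w\<close> the half-plane \<open>Im w > 0\<close> becomes \<open>Re s > 1\<close>. The limit function is
  \<open>(- \<zeta>'/\<zeta> - \<zeta>)(s) / s\<close> in the form \<open>(- h - H'/H)(s) / s\<close>, where \<open>H\<close> is \<open>zeta_reg\<close> and \<open>h\<close> is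
  the difference quotient \<open>(H s - H 1) / (s - 1)\<close>; in this form no pole is left at \<open>s = 1\<close>.
\<close>

lemma psi_mellin_convergent: "convergent (\<lambda>N. \<Sum>m<N. (psi (Suc m) - real (Suc m)) / (real (Suc m) * real (Suc (Suc m))))"
proof -
  define V where "V = {s. Re s > 0} \<inter> {s. zeta_reg s \<noteq> 0}"
  have op: "open {s. Re s > (0::real)}" by (rule open_halfspace_Re_gt)
  have V: "open V"
  proof -
    have "open ({s. Re s > 0} \<inter> zeta_reg -` (- {0}))"
      by (rule continuous_open_preimage[OF holomorphic_on_imp_continuous_on[OF holomorphic_zeta_reg] op]) auto
    then show ?thesis by (simp add: V_def vimage_def)
  qed
  define h where "h = (\<lambda>s. if s = 1 then deriv zeta_reg 1 else (zeta_reg s - zeta_reg 1) / (s - 1))"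
  have h: "h holomorphic_on {s. Re s > 0}"
    unfolding h_def by (rule pole_lemma_open[OF holomorphic_zeta_reg op])
  define g where "g = (\<lambda>s. (- h s - deriv zeta_reg s / zeta_reg s) / s)"
  have g: "g holomorphic_on V"
    unfolding g_def
    by (intro holomorphic_intros holomorphic_on_subset[OF h] holomorphic_on_subset[OF holomorphic_zeta_reg]
        holomorphic_on_subset[OF holomorphic_deriv[OF holomorphic_zeta_reg op]]) (auto simp: V_def)
  have g_eq: "g s = (\<Sum>n. psi_kernel_term n s)" if s: "Re s > 1" for s
  proof -
    have "s \<noteq> 1" using s by auto
    then have "h s = zeta_series s - 1 / (s - 1)" by (simp add: h_def zeta_reg_eq[OF s] diff_divide_distrib)
    moreover have "deriv zeta_reg s / zeta_reg s = 1 / (s - 1) - dirichlet_series mangoldt s"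
      using deriv_zeta_reg_eq[OF s] zeta_reg_nonzero[of s] s by simp
    ultimately show ?thesis by (simp add: g_def psi_kernel_sum_eq[OF s])
  qed
  define U where "U = (\<lambda>w. 1 - \<i> * w) -` V"
  have "open U" unfolding U_def by (rule continuous_open_vimage[OF V]) (intro continuous_intros)
  have "(\<lambda>N. \<Sum>n<N. psi_kernel_term n (1 - \<i> * 0)) \<longlonglongrightarrow> g (1 - \<i> * 0)"
  proof (rule newman_tauberian[of U "\<lambda>w. g (1 - \<i> * w)" "\<lambda>N w. \<Sum>n<N. psi_kernel_term n (1 - \<i> * w)" "\<lambda>n. ln (real (Suc n))" 4])
    show "open U" by fact
    show "{w. 0 \<le> Im w} \<subseteq> U"
      using zeta_reg_nonzero by (auto simp: U_def V_def)
    show "(\<lambda>w. g (1 - \<i> * w)) holomorphic_on U"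
      by (rule holomorphic_on_compose_gen[of "\<lambda>w. 1 - \<i> * w" U g V, OF _ g, unfolded o_def])
        (auto simp: U_def intro!: holomorphic_intros)
    have psi_hol: "psi_kernel_term n holomorphic_on UNIV" for n
      unfolding psi_kernel_term_def by (intro holomorphic_intros holomorphic_gap_kernel)
    have hol: "(\<lambda>w. psi_kernel_term n (1 - \<i> * w)) holomorphic_on UNIV" for n
      by (rule holomorphic_on_compose_gen[of "\<lambda>w. 1 - \<i> * w" UNIV "psi_kernel_term n" UNIV, OF _ psi_hol, unfolded o_def])
        (auto intro!: holomorphic_intros)
    show "\<And>N. (\<lambda>w. \<Sum>n<N. psi_kernel_term n (1 - \<i> * w)) holomorphic_on UNIV"
      by (intro holomorphic_on_sum hol)
    show "filterlim (\<lambda>n. ln (real (Suc n))) at_top sequentially"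
      by real_asymp
    show "norm ((\<Sum>n<N. psi_kernel_term n (1 - \<i> * w)) - g (1 - \<i> * w)) \<le> 4 * exp (- ln (real (Suc N)) * Im w) / Im w"
      if w: "Im w > 0" for N w
    proof -
      have Re: "Re (1 - \<i> * w) = 1 + Im w" by simp
      have "(\<Sum>n. psi_kernel_term n (1 - \<i> * w)) = (\<Sum>n. psi_kernel_term (n + N) (1 - \<i> * w)) + (\<Sum>n<N. psi_kernel_term n (1 - \<i> * w))"
        by (rule suminf_split_initial_segment[OF tail_psi_kernel(1)[OF w Re]])
      then have "(\<Sum>n<N. psi_kernel_term n (1 - \<i> * w)) - g (1 - \<i> * w) = - (\<Sum>n. psi_kernel_term (n + N) (1 - \<i> * w))"
        using g_eq[of "1 - \<i> * w"] w by simp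
      then show ?thesis using tail_psi_kernel(2)[OF w Re, of N] by (simp add: powr_def mult_ac)
    qed
    show "norm (\<Sum>n<N. psi_kernel_term n (1 - \<i> * w)) \<le> 4 * exp (- ln (real (Suc N)) * Im w) / (- Im w)"
      if w: "Im w < 0" for N w
      using head_psi_kernel[OF w, of "1 - \<i> * w" N] by (simp add: powr_def mult_ac)
  qed
  then have "(\<lambda>N. Re (\<Sum>n<N. psi_kernel_term n 1)) \<longlonglongrightarrow> Re (g 1)"
    by (intro tendsto_Re) simp
  moreover have "Re (psi_kernel_term n 1) = (psi (Suc n) - real (Suc n)) / (real (Suc n) * real (Suc (Suc n)))" for n
  proof -
    have "powr_gap n 1 = of_real (1 / real (Suc n) - 1 / real (Suc (Suc n)))"
      by (simp add: powr_gap_def powr_minus field_simps del: of_nat_Suc)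
    also have "1 / real (Suc n) - 1 / real (Suc (Suc n)) = 1 / (real (Suc n) * real (Suc (Suc n)))"
      by (simp add: field_simps)
    finally have gap: "gap_kernel n 1 = of_real (1 / (real (Suc n) * real (Suc (Suc n))))"
      by (simp add: gap_kernel_nonzero)
    show ?thesis unfolding psi_kernel_term_def gap of_real_mult[symmetric] Re_complex_of_real by simp
  qed
  ultimately show ?thesis by (auto simp: convergent_def)
qed

section \<open>The prime number theorem\<close>

lemma sum_inverse_consecutive:
  assumes "0 < M" "M \<le> N"
  shows "(\<Sum>m=M..<N. 1 / (real m * (real m + 1))) = 1 / real M - 1 / real N"
  using assms(2)
proof (induction N rule: dec_induct)
  case (step n)
  have "1 / (real n * (real n + 1)) = 1 / real n - 1 / (real n + 1)"
    using step assms(1) by (simp add: field_simps)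
  then show ?case using step by (simp add: add_ac)
qed simp

definition psi_excess :: "nat \<Rightarrow> real" where
  "psi_excess m = (psi m - real m) / (real m * (real m + 1))"

lemma psi_excess_Cauchy:
  assumes "e > 0"
  shows "\<exists>K>0. \<forall>M\<ge>K. \<forall>N. \<bar>\<Sum>m=M..<N. psi_excess m\<bar> < e"
proof -
  let ?S = "\<lambda>N. \<Sum>m<N. psi_excess (Suc m)"
  have "convergent ?S" using psi_mellin_convergent by (simp add: psi_excess_def add_ac)
  then have "Cauchy ?S" by (rule convergent_Cauchy)
  then obtain K where K: "\<And>M N. M \<ge> K \<Longrightarrow> N \<ge> K \<Longrightarrow> \<bar>?S M - ?S N\<bar> < e"
    using assms unfolding Cauchy_def dist_real_def by blast
  have "\<bar>\<Sum>m=M..<N. psi_excess m\<bar> < e" if M: "M \<ge> Suc K" for M N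
  proof (cases "M \<le> N")
    case True
    obtain M' N' where eq: "M = Suc M'" "N = Suc N'" using M True by (metis Suc_le_D le_trans)
    have "(\<Sum>m=M..<N. psi_excess m) = (\<Sum>m=M'..<N'. psi_excess (Suc m))"
      unfolding eq by (rule sum.shift_bounds_Suc_ivl)
    also have "\<dots> = ?S N' - ?S M'"
      using sum_diff_nat_ivl[of 0 M' N' "\<lambda>m. psi_excess (Suc m)"] True eq by (simp add: atLeast0LessThan)
    finally show ?thesis using K[of N' M'] M True eq by simp
  qed (use assms in auto)
  then show ?thesis by (intro exI[of _ "Suc K"]) auto
qed

text \<open>
  If \<open>\<psi>(N) \<ge> (1 + 2 \<delta>) N\<close>, then by monotonicity \<open>\<psi>(m) - m \<ge> \<delta> N\<close> for all \<open>m\<close> from \<open>N\<close> to \<open>(1 + \<delta>) N\<close>. The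
  corresponding block of the convergent series is at least the fixed constant \<open>e\<close>, which Cauchy's
  criterion forbids for large \<open>N\<close>.
\<close>

lemma psi_eventually_le:
  assumes d: "\<delta> > 0"
  shows "\<forall>\<^sub>F N in sequentially. psi N < (1 + 2 * \<delta>) * real N"
proof -
  define e where "e = \<delta> * (\<delta> / 2) / (1 + \<delta>)"
  have e: "e > 0" using d by (simp add: e_def)
  obtain K where K: "K > 0" "\<And>M N. M \<ge> K \<Longrightarrow> \<bar>\<Sum>m=M..<N. psi_excess m\<bar> < e"
    using psi_excess_Cauchy[OF e] by blast
  have "\<forall>\<^sub>F N in sequentially. N \<ge> K" "\<forall>\<^sub>F N in sequentially. real N \<ge> 2 / \<delta>"
    by real_asymp+
  then show ?thesis
  proof eventually_elim
    case (elim N)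
    show ?case
    proof (rule ccontr)
      assume "\<not> psi N < (1 + 2 * \<delta>) * real N"
      then have psi: "psi N \<ge> (1 + 2 * \<delta>) * real N" by simp
      have N0: "real N > 0" using elim K by simp
      define M where "M = nat \<lfloor>(1 + \<delta>) * real N\<rfloor>"
      have dN: "\<delta> * real N \<ge> 2" using elim d by (simp add: field_simps)
      have M: "real M \<le> (1 + \<delta>) * real N" "real M > (1 + \<delta>) * real N - 1"
        using d N0 by (auto simp: M_def of_nat_nat)
      have "real N \<le> real M" using M dN by (simp add: algebra_simps)
      then have NM: "N \<le> M" by simp
      have "e \<le> \<delta> * real N * (1 / real N - 1 / real M)"
      proof -
        have "\<delta> / 2 * real N \<le> real M - real N" using M dN by (simp add: algebra_simps)
        moreover have "real N \<ge> real M / (1 + \<delta>)" using M d by (simp add: field_simps)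
        moreover have "\<delta> / 2 * (real M / (1 + \<delta>)) \<le> \<delta> / 2 * real N" using M(1) d by (intro mult_left_mono) (auto simp: field_simps)
        ultimately have "\<delta> / 2 * (real M / (1 + \<delta>)) \<le> real M - real N" by linarith
        then have "\<delta> * (\<delta> / 2 * (real M / (1 + \<delta>))) / real M \<le> \<delta> * (real M - real N) / real M"
          using d by (intro divide_right_mono mult_left_mono) auto
        moreover have M0: "real M > 0" using NM N0 by simp
        moreover have "e = \<delta> * (\<delta> / 2 * (real M / (1 + \<delta>))) / real M"
          using M0 by (simp add: e_def)
        moreover have "\<delta> * real N * (1 / real N - 1 / real M) = \<delta> * (real M - real N) / real M"
          using M0 N0 by (simp add: field_simps)
        ultimately show ?thesis by simp
      qed
      also have "\<dots> = (\<Sum>m=N..<M. \<delta> * real N * (1 / (real m * (real m + 1))))"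
        using sum_inverse_consecutive[of N M] N0 NM by (simp flip: sum_distrib_left del: times_divide_eq_right)
      also have "\<dots> \<le> (\<Sum>m=N..<M. psi_excess m)"
      proof (intro sum_mono)
        fix m assume m: "m \<in> {N..<M}"
        then have "psi m \<ge> psi N" "real m \<le> real M" by (auto intro: psi_mono)
        then have "\<delta> * real N \<le> psi m - real m" using psi M(1) by (simp add: algebra_simps)
        then show "\<delta> * real N * (1 / (real m * (real m + 1))) \<le> psi_excess m"
          by (simp add: psi_excess_def divide_right_mono)
      qed
      also have "\<dots> < e" using K(2)[of N M] elim by simp
      finally show False by simp
    qed
  qed
qed

text \<open>
  The mirror image of \<open>psi_eventually_le\<close>, with the block from \<open>(1 - \<delta>) N\<close> to \<open>N\<close>.
\<close>

lemma psi_eventually_ge: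
  assumes d: "\<delta> > 0" "\<delta> < 1 / 2"
  shows "\<forall>\<^sub>F N in sequentially. psi N > (1 - 2 * \<delta>) * real N"
proof -
  define e where "e = \<delta> * (\<delta> / 2)"
  have e: "e > 0" using d by (simp add: e_def)
  obtain K where K: "K > 0" "\<And>M N. M \<ge> K \<Longrightarrow> \<bar>\<Sum>m=M..<N. psi_excess m\<bar> < e"
    using psi_excess_Cauchy[OF e] by blast
  have "\<forall>\<^sub>F N in sequentially. N \<ge> 2 * K" "\<forall>\<^sub>F N in sequentially. real N \<ge> 2 / \<delta>"
    by real_asymp+
  then show ?thesis
  proof eventually_elim
    case (elim N)
    show ?case
    proof (rule ccontr)
      assume "\<not> psi N > (1 - 2 * \<delta>) * real N"
      then have psi: "psi N \<le> (1 - 2 * \<delta>) * real N" by simp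
      have N0: "real N > 0" using elim K by simp
      define M where "M = nat \<lceil>(1 - \<delta>) * real N\<rceil>"
      have dN: "\<delta> * real N \<ge> 2" using elim d by (simp add: field_simps)
      have "(1 - \<delta>) * real N \<ge> 1 / 2 * real N" using d by (intro mult_right_mono) auto
      then have half: "(1 - \<delta>) * real N \<ge> real K" using elim by simp
      have M: "real M \<ge> (1 - \<delta>) * real N" "real M < (1 - \<delta>) * real N + 1"
        using half ceiling_correct[of "(1 - \<delta>) * real N"] K(1) unfolding M_def by linarith+
      have "real M \<le> real N" using M dN by (simp add: algebra_simps)
      then have NM: "M \<le> N" by simp
      have "real K \<le> real M" using M half by linarith
      then have MK: "M \<ge> K" by simp
      have M0: "real M > 0" using MK K by simp
      have "e \<le> \<delta> * real N * (1 / real M - 1 / real N)"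
      proof -
        have "\<delta> / 2 * real N \<le> real N - real M" using M dN by (simp add: algebra_simps)
        moreover have "\<delta> / 2 * real M \<le> \<delta> / 2 * real N" using NM d by (intro mult_left_mono) auto
        ultimately have "\<delta> / 2 * real M \<le> real N - real M" by linarith
        then have "\<delta> * (\<delta> / 2 * real M) / real M \<le> \<delta> * (real N - real M) / real M"
          using d by (intro divide_right_mono mult_left_mono) auto
        moreover have "e = \<delta> * (\<delta> / 2 * real M) / real M" using M0 by (simp add: e_def)
        moreover have "\<delta> * real N * (1 / real M - 1 / real N) = \<delta> * (real N - real M) / real M"
          using M0 N0 by (simp add: field_simps)
        ultimately show ?thesis by simp
      qed
      also have "\<dots> = (\<Sum>m=M..<N. \<delta> * real N * (1 / (real m * (real m + 1))))"
        using sum_inverse_consecutive[of M N] M0 NM by (simp flip: sum_distrib_left del: times_divide_eq_right)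
      also have "\<dots> \<le> (\<Sum>m=M..<N. - psi_excess m)"
      proof (intro sum_mono)
        fix m assume m: "m \<in> {M..<N}"
        then have "psi m \<le> psi N" "real m \<ge> real M" by (auto intro: psi_mono)
        then have "\<delta> * real N \<le> - (psi m - real m)" using psi M(1) by (simp add: algebra_simps)
        then have "\<delta> * real N / (real m * (real m + 1)) \<le> - (psi m - real m) / (real m * (real m + 1))"
          by (intro divide_right_mono) auto
        then show "\<delta> * real N * (1 / (real m * (real m + 1))) \<le> - psi_excess m"
          by (simp add: psi_excess_def minus_divide_left)
      qed
      also have "\<dots> < e" using K(2)[of M N] MK by (simp add: sum_negf)
      finally show False by simp
    qed
  qed
qed

theorem psi_asymptotic: "(\<lambda>n. psi n / real n) \<longlonglongrightarrow> 1"
proof (rule tendstoI)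
  fix e :: real assume e: "e > 0"
  \<comment> \<open>The lower estimate is available for \<open>\<delta> < 1/2\<close> only.\<close>
  define d where "d = min (e / 2) (1 / 4)"
  have d: "d > 0" "d < 1 / 2" "2 * d \<le> e" using e by (auto simp: d_def)
  show "\<forall>\<^sub>F n in sequentially. dist (psi n / real n) 1 < e"
    using psi_eventually_le[OF d(1)] psi_eventually_ge[OF d(1,2)] eventually_gt_at_top[of 0]
  proof eventually_elim
    case (elim n)
    then have "psi n / real n < 1 + 2 * d" "psi n / real n > 1 - 2 * d" by (simp_all add: field_simps)
    then show ?case using d by (simp add: dist_real_def abs_if)
  qed
qed

definition prime_count :: "nat \<Rightarrow> nat" where
  "prime_count x = card {p. prime p \<and> p \<le> x}"

lemma finite_primes_le [simp]: "finite {p::nat. prime p \<and> p \<le> x}"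
  by (rule finite_subset[of _ "{..x}"]) auto

text \<open>
  A prime \<open>p\<close> contributes \<open>ln p\<close> once for each of its powers up to \<open>x\<close>; there are at most
  \<open>ln x / ln p\<close> of these, so its total share is at most \<open>ln x\<close>.
\<close>

lemma psi_le_prime_count: "psi x \<le> real (prime_count x) * ln (real x)"
proof -
  let ?P = "{p. prime p \<and> p \<le> x}"
  let ?Q = "{n\<in>{1..x}. primepow n}"
  have "psi x = (\<Sum>n\<in>?Q. ln (real (aprimedivisor n)))"
    unfolding psi_def by (rule sum.mono_neutral_cong_right) (auto simp: mangoldt_def)
  also have "\<dots> = (\<Sum>p\<in>?P. \<Sum>n | n \<in> ?Q \<and> aprimedivisor n = p. ln (real (aprimedivisor n)))"
  proof (rule sum.group[symmetric])
    show "aprimedivisor ` ?Q \<subseteq> ?P"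
    proof safe
      fix n :: nat assume n: "n \<in> {1..x}" "primepow n"
      show "prime (aprimedivisor n)" using n by (intro prime_aprimedivisor') (auto dest: primepow_gt_Suc_0)
      have "aprimedivisor n \<le> n" using n by (intro dvd_imp_le aprimedivisor_dvd') (auto dest: primepow_gt_Suc_0)
      then show "aprimedivisor n \<le> x" using n by simp
    qed
  qed auto
  also have "\<dots> \<le> (\<Sum>p\<in>?P. ln (real x))"
  proof (rule sum_mono)
    fix p assume "p \<in> ?P"
    then have p: "prime p" "p \<le> x" by auto
    have p1: "real p > 1" using p(1) prime_gt_1_nat by simp
    have x0: "real x > 0" using p p1 by linarith
    define K where "K = nat \<lfloor>ln (real x) / ln (real p)\<rfloor>"
    have "{n. n \<in> ?Q \<and> aprimedivisor n = p} \<subseteq> (\<lambda>k. p ^ k) ` {1..K}"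
    proof safe
      fix n assume n: "n \<in> {1..x}" "primepow n" "p = aprimedivisor n"
      obtain q k where qk: "prime q" "k > 0" "n = q ^ k" using n(2) by (auto simp: primepow_def)
      then have nk: "n = p ^ k" using n(3) by (simp add: aprimedivisor_prime_power)
      have "p ^ k \<le> x" using n(1) nk by simp
      then have "real p ^ k \<le> real x" by (metis of_nat_le_iff of_nat_power)
      then have "ln (real p ^ k) \<le> ln (real x)" using p1 x0 by (subst ln_le_cancel_iff) auto
      then have "real k \<le> ln (real x) / ln (real p)" using p1 by (simp add: ln_realpow field_simps)
      then have "k \<le> K" unfolding K_def by (simp add: le_nat_floor)
      then show "n \<in> (\<lambda>k. aprimedivisor n ^ k) ` {1..K}" using nk qk(2) n(3) by auto
    qed
    then have "card {n. n \<in> ?Q \<and> aprimedivisor n = p} \<le> K"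
      using surj_card_le[of "{1..K}"] by simp
    then have "real (card {n. n \<in> ?Q \<and> aprimedivisor n = p}) * ln (real p) \<le> real K * ln (real p)"
      using p1 by (intro mult_right_mono) auto
    also have "\<dots> \<le> ln (real x) / ln (real p) * ln (real p)"
      using p1 x0 p(2) unfolding K_def by (intro mult_right_mono of_nat_floor) auto
    also have "\<dots> = ln (real x)" using p1 by simp
    finally show "(\<Sum>n | n \<in> ?Q \<and> aprimedivisor n = p. ln (real (aprimedivisor n))) \<le> ln (real x)" by simp
  qed
  finally show ?thesis by (simp add: prime_count_def)
qed

text \<open>
  Primes above \<open>y\<close> each contribute at least \<open>ln y\<close> to \<open>\<psi>(x)\<close>. The cutoff \<open>y = x / (ln x)\<^sup>2\<close> will make
  \<open>y\<close> negligible against \<open>x / ln x\<close> while \<open>ln y\<close> stays asymptotic to \<open>ln x\<close>.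
\<close>

lemma prime_count_le:
  fixes y :: real
  assumes y: "y > 1"
  shows "real (prime_count x) \<le> y + psi x / ln y"
proof -
  let ?A = "{p. prime p \<and> p \<le> x \<and> real p > y}"
  have fin: "finite ?A" by (rule finite_subset[of _ "{..x}"]) auto
  have "{p. prime p \<and> p \<le> x} \<subseteq> {1..nat \<lfloor>y\<rfloor>} \<union> ?A"
  proof
    fix p assume p: "p \<in> {p. prime p \<and> p \<le> x}"
    then show "p \<in> {1..nat \<lfloor>y\<rfloor>} \<union> ?A"
      by (cases "real p > y") (auto simp: le_nat_floor Suc_le_eq prime_gt_0_nat)
  qed
  then have "prime_count x \<le> card ({1..nat \<lfloor>y\<rfloor>} \<union> ?A)" unfolding prime_count_def
    using fin by (intro card_mono) auto
  also have "\<dots> \<le> nat \<lfloor>y\<rfloor> + card ?A" using card_Un_le[of "{1..nat \<lfloor>y\<rfloor>}" ?A] by simp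
  finally have "real (prime_count x) \<le> real (nat \<lfloor>y\<rfloor>) + real (card ?A)" by linarith
  also have "real (nat \<lfloor>y\<rfloor>) \<le> y" using y by (intro of_nat_floor) auto
  also have "real (card ?A) \<le> psi x / ln y"
  proof -
    have "real (card ?A) * ln y = (\<Sum>p\<in>?A. ln y)" by simp
    also have "\<dots> \<le> (\<Sum>p\<in>?A. mangoldt p)" using y by (intro sum_mono) auto
    also have "\<dots> \<le> psi x" unfolding psi_def
      by (intro sum_mono2 mangoldt_nonneg) (auto simp: Suc_le_eq prime_gt_0_nat)
    finally show ?thesis using y by (simp add: field_simps)
  qed
  finally show ?thesis by simp
qed

theorem prime_number_theorem: "(\<lambda>n. real (prime_count n) * ln (real n) / real n) \<longlonglongrightarrow> 1"
proof (rule tendsto_sandwich)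
  show "(\<lambda>n. psi n / real n) \<longlonglongrightarrow> 1" by (rule psi_asymptotic)
  show "\<forall>\<^sub>F n in sequentially. psi n / real n \<le> real (prime_count n) * ln (real n) / real n"
    by (intro always_eventually allI divide_right_mono psi_le_prime_count) auto
  let ?y = "\<lambda>n. real n / ln (real n) ^ 2"
  show "\<forall>\<^sub>F n in sequentially. real (prime_count n) * ln (real n) / real n \<le>
      1 / ln (real n) + psi n / real n * (ln (real n) / ln (?y n))"
  proof -
    have "\<forall>\<^sub>F n in sequentially. ?y n > 1" "\<forall>\<^sub>F n in sequentially. ln (real n) > 0" "\<forall>\<^sub>F n in sequentially. real n > 0"
      by real_asymp+
    then show ?thesis
    proof eventually_elim
      case (elim n)
      have "real (prime_count n) * ln (real n) / real n \<le> (?y n + psi n / ln (?y n)) * ln (real n) / real n"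
        using elim by (intro divide_right_mono mult_right_mono prime_count_le) auto
      also have "\<dots> = 1 / ln (real n) + psi n / real n * (ln (real n) / ln (?y n))"
        using elim by (simp add: add_divide_distrib distrib_right power2_eq_square)
      finally show ?case .
    qed
  qed
  have "(\<lambda>n. 1 / ln (real n)) \<longlonglongrightarrow> 0" "(\<lambda>n. ln (real n) / ln (?y n)) \<longlonglongrightarrow> 1" by real_asymp+
  from tendsto_add[OF this(1) tendsto_mult[OF psi_asymptotic this(2)]]
  show "(\<lambda>n. 1 / ln (real n) + psi n / real n * (ln (real n) / ln (?y n))) \<longlonglongrightarrow> 1" by simp
qed

section \<open>Brun's pure sieve for n (n + 2)\<close>

text \<open>
  Representing the class by \<open>r\<close> with \<open>1 \<le> r \<le> M\<close>, not by a remainder, makes this count exact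
  without a case distinction for multiples of \<open>M\<close>.
\<close>

lemma card_residue_class:
  assumes r: "1 \<le> r" "r \<le> M"
  shows "card {n\<in>{1..X}. [n = r] (mod M)} = (X + M - r) div M"
proof (induction X)
  case 0
  then show ?case using r by simp
next
  case (Suc X)
  have M: "M > 0" using r by simp
  have eq: "Suc X + M - r = Suc (X + M - r)" using r by simp
  have iff: "[Suc X = r] (mod M) \<longleftrightarrow> Suc (X + M - r) mod M = 0"
  proof -
    have "[Suc X = r] (mod M) \<longleftrightarrow> [Suc X + M = r + 0] (mod M)"
      unfolding cong_def by (simp only: mod_add_self2 add_0_right)
    also have "Suc X + M = r + Suc (X + M - r)" using r by simp
    also have "[r + Suc (X + M - r) = r + 0] (mod M) \<longleftrightarrow> [Suc (X + M - r) = 0] (mod M)"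
      by (rule cong_add_lcancel_nat)
    finally show ?thesis by (simp add: cong_def)
  qed
  have "{n\<in>{1..Suc X}. [n = r] (mod M)} = {n\<in>{1..X}. [n = r] (mod M)} \<union> (if [Suc X = r] (mod M) then {Suc X} else {})"
    by (auto simp: le_Suc_eq)
  then have "card {n\<in>{1..Suc X}. [n = r] (mod M)} = card {n\<in>{1..X}. [n = r] (mod M)} + (if [Suc X = r] (mod M) then 1 else 0)"
    by (auto simp: card_insert_if)
  then show ?case unfolding Suc.IH eq div_Suc iff by simp
qed

lemma card_residue_class_approx:
  assumes M: "M > 0"
  shows "\<bar>real (card {n\<in>{1..X}. [n = c] (mod M)}) - real X / real M\<bar> \<le> 1"
proof -
  define r where "r = (if c mod M = 0 then M else c mod M)"
  have r: "1 \<le> r" "r \<le> M" using M mod_less_divisor[OF M, of c] by (auto simp: r_def)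
  have "[n = c] (mod M) \<longleftrightarrow> [n = r] (mod M)" for n by (auto simp: cong_def r_def)
  then have card: "card {n\<in>{1..X}. [n = c] (mod M)} = (X + M - r) div M" using card_residue_class[OF r] by simp
  let ?q = "(X + M - r) div M"
  have "?q * M \<le> X + M - r" "X + M - r < (?q + 1) * M"
    using dividend_less_div_times[OF M, of "X + M - r"] by (simp_all only: div_times_less_eq_dividend distrib_right mult_1 add.commute)
  then have "?q * M < X + M" "X < (?q + 1) * M" using r by linarith+
  then have "real ?q * real M < real X + real M" "real X < (real ?q + 1) * real M"
    by (metis of_nat_add of_nat_less_iff of_nat_mult, metis of_nat_1 of_nat_add of_nat_less_iff of_nat_mult)
  then have "real ?q < real X / real M + 1" "real X / real M < real ?q + 1" using M by (simp_all add: field_simps)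
  then show ?thesis unfolding card by (simp add: abs_if)
qed

text \<open>
  By the Chinese remainder theorem the two conditions describe one residue class modulo \<open>a b\<close>; the
  class of \<open>-2\<close> modulo \<open>b\<close> is represented by the natural number \<open>2 (b - 1)\<close>.
\<close>

lemma card_two_divisibility_approx:
  assumes "coprime a b" "a > 0" "b > 0"
  shows "\<bar>real (card {n\<in>{1..X}. a dvd n \<and> b dvd n + 2}) - real X / real (a * b)\<bar> \<le> 1"
proof -
  obtain x where x: "[x = 0] (mod a)" "[x = 2 * (b - 1)] (mod b)"
    using binary_chinese_remainder_nat[OF assms(1)] by blast
  have "[x + 2 = 2 * (b - 1) + 2] (mod b)" using x(2) by (rule cong_add) simp
  also have "2 * (b - 1) + 2 = 2 * b" using assms(3) by simp
  finally have x2: "[0 = x + 2] (mod b)" by (simp add: cong_def)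
  have "a dvd n \<and> b dvd n + 2 \<longleftrightarrow> [n = x] (mod a * b)" for n
  proof -
    have "a dvd n \<longleftrightarrow> [n = x] (mod a)" using x(1) by (metis cong_0_iff cong_sym cong_trans)
    moreover have "b dvd n + 2 \<longleftrightarrow> [n + 2 = x + 2] (mod b)" using x2 by (metis cong_0_iff cong_sym cong_trans)
    moreover have "[n + 2 = x + 2] (mod b) \<longleftrightarrow> [n = x] (mod b)" by (rule cong_add_rcancel_nat)
    ultimately show ?thesis using assms(1) coprime_cong_mult_nat cong_modulus_mult_nat by (metis mult.commute)
  qed
  then show ?thesis using card_residue_class_approx[of "a * b" X x] assms by simp
qed

lemma prod_primes_dvd_iff:
  assumes "finite E" "\<And>p. p \<in> E \<Longrightarrow> prime (p::nat)"
  shows "\<Prod>E dvd n \<longleftrightarrow> (\<forall>p\<in>E. p dvd n)"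
  using assms
proof (induction E rule: finite_induct)
  case (insert q E)
  have "coprime q (\<Prod>E)"
    using insert by (intro prod_coprime_right) (metis insertCI primes_coprime)
  then show ?case using insert by (auto intro: divides_mult dvd_mult_left dvd_mult_right)
qed simp

text \<open>
  An odd prime divides at most one of \<open>n\<close> and \<open>n + 2\<close>. Splitting \<open>n\<close> by the set \<open>E\<close> of those primes in \<open>D\<close>
  that divide \<open>n\<close> itself gives \<open>2\<^bsup>card D\<^esup>\<close> disjoint residue classes modulo \<open>\<Prod>D\<close>, each counted with
  an error of at most \<open>1\<close>.
\<close>

lemma card_twin_divisibility_approx:
  assumes D: "finite D" "\<And>p. p \<in> D \<Longrightarrow> prime (p::nat) \<and> odd p"
  shows "\<bar>real (card {n\<in>{1..X}. \<forall>p\<in>D. p dvd n * (n + 2)}) - real X * (\<Prod>p\<in>D. 2 / real p)\<bar> \<le> 2 ^ card D"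
proof -
  let ?N = "\<lambda>E. {n\<in>{1..X}. \<Prod>E dvd n \<and> \<Prod>(D - E) dvd n + 2}"
  have dvd: "\<Prod>E dvd n \<longleftrightarrow> (\<forall>p\<in>E. p dvd n)" if "E \<subseteq> D" for E n
    using that D by (intro prod_primes_dvd_iff) (auto intro: finite_subset)
  have not_both: "\<not> (p dvd n \<and> p dvd n + 2)" if "p \<in> D" for p n
  proof
    assume "p dvd n \<and> p dvd n + 2"
    then have "p dvd 2" using dvd_add_right_iff by blast
    then have "p \<le> 2" by (rule dvd_imp_le) simp
    moreover have "p \<ge> 2" "odd p" using D that prime_ge_2_nat by blast+
    ultimately show False by (metis dvd_refl le_antisym)
  qed
  have un: "{n\<in>{1..X}. \<forall>p\<in>D. p dvd n * (n + 2)} = (\<Union>E\<in>Pow D. ?N E)"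
  proof (intro equalityI subsetI)
    fix n assume n: "n \<in> {n\<in>{1..X}. \<forall>p\<in>D. p dvd n * (n + 2)}"
    have "p dvd n \<or> p dvd n + 2" if "p \<in> D" for p
      using n that D prime_dvd_mult_iff by blast
    then have "\<Prod>(D - {p\<in>D. p dvd n}) dvd n + 2"
      using dvd[of "D - {p\<in>D. p dvd n}" "n + 2"] by blast
    moreover have "\<Prod>{p\<in>D. p dvd n} dvd n"
      using dvd[of "{p\<in>D. p dvd n}" n] by blast
    ultimately have "n \<in> ?N {p\<in>D. p dvd n}" using n by (simp only: mem_Collect_eq simp_thms)
    then show "n \<in> (\<Union>E\<in>Pow D. ?N E)" by (rule UN_I[rotated]) blast
  next
    fix n assume "n \<in> (\<Union>E\<in>Pow D. ?N E)"
    then obtain E where E: "E \<subseteq> D" "n \<in> ?N E" by blast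
    then have "p dvd n \<or> p dvd n + 2" if "p \<in> D" for p
      using dvd[OF E(1), of n] dvd[of "D - E" "n + 2"] that by blast
    then have "p dvd n * (n + 2)" if "p \<in> D" for p
      using that dvd_mult2[of p n "n + 2"] dvd_mult[of p "n + 2" n] by blast
    then show "n \<in> {n\<in>{1..X}. \<forall>p\<in>D. p dvd n * (n + 2)}" using E by blast
  qed
  have disj: "?N E \<inter> ?N E' = {}" if "E \<subseteq> D" "E' \<subseteq> D" "E \<noteq> E'" for E E'
  proof (rule ccontr)
    assume "?N E \<inter> ?N E' \<noteq> {}"
    then obtain n where n: "n \<in> ?N E" "n \<in> ?N E'" by blast
    have eqF: "F = {p\<in>D. p dvd n}" if "F \<subseteq> D" "n \<in> ?N F" for F
    proof -
      from that(2) have F: "\<Prod>F dvd n" "\<Prod>(D - F) dvd n + 2" by blast+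
      have F1: "p dvd n" if "p \<in> F" for p using F(1) dvd[OF \<open>F \<subseteq> D\<close>, of n] that by blast
      have F2: "p dvd n + 2" if "p \<in> D - F" for p using F(2) dvd[of "D - F" "n + 2"] that by blast
      show ?thesis
      proof (intro equalityI subsetI)
        fix p assume "p \<in> F"
        then show "p \<in> {p\<in>D. p dvd n}" using F1 \<open>F \<subseteq> D\<close> by blast
      next
        fix p assume p: "p \<in> {p\<in>D. p dvd n}"
        then have "\<not> p dvd n + 2" using not_both by blast
        then show "p \<in> F" using F2 p by blast
      qed
    qed
    show False using that(3) trans[OF eqF[OF that(1) n(1)] sym[OF eqF[OF that(2) n(2)]]] by (rule notE)
  qed
  have "card {n\<in>{1..X}. \<forall>p\<in>D. p dvd n * (n + 2)} = (\<Sum>E\<in>Pow D. card (?N E))"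
    unfolding un
  proof (rule card_UN_disjoint)
    show "\<forall>E\<in>Pow D. \<forall>E'\<in>Pow D. E \<noteq> E' \<longrightarrow> ?N E \<inter> ?N E' = {}" using disj by blast
  qed (use D(1) in simp_all)
  then have "real (card {n\<in>{1..X}. \<forall>p\<in>D. p dvd n * (n + 2)}) = (\<Sum>E\<in>Pow D. real (card (?N E)))"
    by (simp only: of_nat_sum)
  moreover have "real X * (\<Prod>p\<in>D. 2 / real p) = (\<Sum>E\<in>Pow D. real X / real (\<Prod>D))"
    using D(1) by (simp add: card_Pow prod_dividef)
  ultimately have "\<bar>real (card {n\<in>{1..X}. \<forall>p\<in>D. p dvd n * (n + 2)}) - real X * (\<Prod>p\<in>D. 2 / real p)\<bar>
      = \<bar>\<Sum>E\<in>Pow D. real (card (?N E)) - real X / real (\<Prod>D)\<bar>"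
    by (simp only: sum_subtractf)
  also have "\<dots> \<le> (\<Sum>E\<in>Pow D. \<bar>real (card (?N E)) - real X / real (\<Prod>D)\<bar>)" by (rule sum_abs)
  also have "\<dots> \<le> (\<Sum>E\<in>Pow D. 1)"
  proof (rule sum_mono)
    fix E assume "E \<in> Pow D"
    then have E: "E \<subseteq> D" "finite E" using D(1) by (auto intro: finite_subset)
    have "coprime p q" if "p \<in> E" "q \<in> D - E" for p q
      using that E D(2) by (intro primes_coprime) auto
    then have "coprime (\<Prod>E) (\<Prod>(D - E))"
      by (intro prod_coprime_left prod_coprime_right) auto
    moreover have "\<Prod>D = \<Prod>E * \<Prod>(D - E)" using E D(1) by (simp add: prod.subset_diff mult.commute)
    moreover have "\<Prod>E > 0" "\<Prod>(D - E) > 0"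
      using E D(2) by (auto intro!: prod_pos simp: prime_gt_0_nat)
    ultimately show "\<bar>real (card (?N E)) - real X / real (\<Prod>D)\<bar> \<le> 1"
      using card_two_divisibility_approx[of "\<Prod>E" "\<Prod>(D - E)" X] by simp
  qed
  finally show ?thesis using D(1) by (simp add: card_Pow)
qed

text \<open>
  Bonferroni's inequality for one integer: the alternating sum of binomial coefficients, stopped at
  an even index \<open>m\<close>, equals \<open>card Q - 1\<close> choose \<open>m\<close> when \<open>Q\<close> is nonempty, hence is not negative.
\<close>

lemma bonferroni_truncated:
  assumes Q: "finite Q" and m: "even m"
  shows "(if Q = {} then 1 else 0) \<le> (\<Sum>D | D \<subseteq> Q \<and> card D \<le> m. (-1) ^ card D :: real)"
proof (cases "Q = {}")
  case True
  have "{D. D \<subseteq> {} \<and> card D \<le> m} = {{} :: 'a set}" by auto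
  then show ?thesis using True by simp
next
  case False
  let ?A = "{D. D \<subseteq> Q \<and> card D \<le> m}"
  have finA: "finite ?A" using Q by simp
  have "(\<Sum>D\<in>?A. (-1) ^ card D :: real) = (\<Sum>j\<le>m. \<Sum>D | D \<in> ?A \<and> card D = j. (-1) ^ card D)"
    by (rule sum.group[symmetric]) (use finA in auto)
  also have "\<dots> = (\<Sum>j\<le>m. (real (card Q) gchoose j) * (-1) ^ j)"
  proof (rule sum.cong)
    fix j assume "j \<in> {..m}"
    then have "{D. D \<in> ?A \<and> card D = j} = {D. D \<subseteq> Q \<and> card D = j}" by auto
    then show "(\<Sum>D | D \<in> ?A \<and> card D = j. (-1) ^ card D) = (real (card Q) gchoose j) * (-1) ^ j"
      using n_subsets[OF Q, of j] by (simp add: binomial_gbinomial)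
  qed simp
  also have "\<dots> = (-1) ^ m * (real (card Q) - 1 gchoose m)" by (rule gbinomial_sum_lower_neg)
  also have "real (card Q) - 1 = real (card Q - 1)" using False Q by (simp add: of_nat_diff card_gt_0_iff Suc_le_eq)
  also have "(-1) ^ m * (real (card Q - 1) gchoose m) = real ((card Q - 1) choose m)"
    using m by (simp add: binomial_gbinomial)
  finally show ?thesis using False by simp
qed

text \<open>
  Apply \<open>bonferroni_truncated\<close> to the set of sieving primes that divide \<open>n (n + 2)\<close>, sum over \<open>n\<close>, and
  exchange the order of summation.
\<close>

lemma brun_sieve:
  assumes P: "finite P" "\<And>p. p \<in> P \<Longrightarrow> prime (p::nat) \<and> odd p" and m: "even m"
  shows "real (card {n\<in>{1..X}. \<forall>p\<in>P. \<not> p dvd n * (n + 2)}) \<le>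
    (\<Sum>D | D \<subseteq> P \<and> card D \<le> m. (-1) ^ card D * (real X * (\<Prod>p\<in>D. 2 / real p)) + 2 ^ card D)"
proof -
  let ?Q = "\<lambda>n. {p\<in>P. p dvd n * (n + 2)}"
  let ?A = "{D. D \<subseteq> P \<and> card D \<le> m}"
  have finA: "finite ?A" using P(1) by simp
  have "real (card {n\<in>{1..X}. \<forall>p\<in>P. \<not> p dvd n * (n + 2)}) = (\<Sum>n\<in>{1..X}. if ?Q n = {} then 1 else 0)"
    by (simp add: sum.If_cases) (rule arg_cong[of _ _ card], auto)
  also have "\<dots> \<le> (\<Sum>n\<in>{1..X}. \<Sum>D | D \<subseteq> ?Q n \<and> card D \<le> m. (-1) ^ card D)"
    using P(1) m by (intro sum_mono bonferroni_truncated) auto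
  also have "\<dots> = (\<Sum>n\<in>{1..X}. \<Sum>D\<in>?A. if \<forall>p\<in>D. p dvd n * (n + 2) then (-1) ^ card D else 0)"
  proof (rule sum.cong)
    fix n
    have "{D. D \<subseteq> ?Q n \<and> card D \<le> m} = {D\<in>?A. \<forall>p\<in>D. p dvd n * (n + 2)}" by auto
    then show "(\<Sum>D | D \<subseteq> ?Q n \<and> card D \<le> m. (-1) ^ card D) = (\<Sum>D\<in>?A. if \<forall>p\<in>D. p dvd n * (n + 2) then (-1) ^ card D else (0::real))"
      using sum.inter_filter[OF finA, of "\<lambda>D. (-1) ^ card D" "\<lambda>D. \<forall>p\<in>D. p dvd n * (n + 2)"] by simp
  qed simp
  also have "\<dots> = (\<Sum>D\<in>?A. \<Sum>n\<in>{1..X}. if \<forall>p\<in>D. p dvd n * (n + 2) then (-1) ^ card D else 0)"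
    by (rule sum.swap)
  also have "\<dots> = (\<Sum>D\<in>?A. (-1) ^ card D * real (card {n\<in>{1..X}. \<forall>p\<in>D. p dvd n * (n + 2)}))"
    by (intro sum.cong) (simp_all flip: sum.inter_filter)
  also have "\<dots> \<le> (\<Sum>D\<in>?A. (-1) ^ card D * (real X * (\<Prod>p\<in>D. 2 / real p)) + 2 ^ card D)"
  proof (rule sum_mono)
    fix D assume D: "D \<in> ?A"
    then have "\<bar>real (card {n\<in>{1..X}. \<forall>p\<in>D. p dvd n * (n + 2)}) - real X * (\<Prod>p\<in>D. 2 / real p)\<bar> \<le> 2 ^ card D"
      using P by (intro card_twin_divisibility_approx) (auto intro: finite_subset)
    then show "(-1) ^ card D * real (card {n\<in>{1..X}. \<forall>p\<in>D. p dvd n * (n + 2)}) \<le> (-1) ^ card D * (real X * (\<Prod>p\<in>D. 2 / real p)) + 2 ^ card D"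
      by (cases "even (card D)") (auto simp: abs_le_iff)
  qed
  finally show ?thesis .
qed

lemma prod_one_plus_le_exp:
  fixes f :: "'a \<Rightarrow> real"
  assumes "\<And>p. p \<in> P \<Longrightarrow> f p \<ge> 0"
  shows "(\<Prod>p\<in>P. 1 + f p) \<le> exp (\<Sum>p\<in>P. f p)"
proof (cases "finite P")
  case True
  have "(\<Prod>p\<in>P. 1 + f p) \<le> (\<Prod>p\<in>P. exp (f p))"
    using assms by (intro prod_mono) (auto intro: exp_ge_add_one_self add_nonneg_nonneg)
  then show ?thesis using True by (simp add: exp_sum)
qed simp

text \<open>
  Without the truncation the sum is exactly the product. The missing sets have more than \<open>m\<close>
  elements, so weighting each by \<open>2\<close> to the power \<open>card D - m\<close> only increases it (Rankin's trick), and the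
  weighted sum over all sets is again a product.
\<close>

lemma brun_main_term:
  assumes P: "finite P" "\<And>p. p \<in> P \<Longrightarrow> (p::nat) > 0"
  shows "(\<Sum>D | D \<subseteq> P \<and> card D \<le> m. (-1) ^ card D * (\<Prod>p\<in>D. 2 / real p)) \<le>
     (\<Prod>p\<in>P. 1 - 2 / real p) + exp (4 * (\<Sum>p\<in>P. 1 / real p)) / 2 ^ m"
proof -
  let ?t = "\<lambda>D. \<Prod>p\<in>D. 2 / real p"
  let ?A = "{D. D \<subseteq> P \<and> card D \<le> m}" and ?B = "{D. D \<subseteq> P \<and> \<not> card D \<le> m}"
  have t0: "?t D \<ge> 0" for D by (intro prod_nonneg) auto
  have "Pow P = ?A \<union> ?B" by auto
  then have "(\<Sum>D\<in>Pow P. (-1) ^ card D * ?t D) = (\<Sum>D\<in>?A. (-1) ^ card D * ?t D) + (\<Sum>D\<in>?B. (-1) ^ card D * ?t D)"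
    using P(1) by (simp only:) (rule sum.union_disjoint, auto)
  moreover have "(\<Prod>p\<in>P. 1 - 2 / real p) = (\<Sum>D\<in>Pow P. (-1) ^ card D * ?t D)"
    using prod_diff_conv_sum[OF P(1), of "\<lambda>_. 1" "\<lambda>p. 2 / real p"] by simp
  ultimately have "(\<Sum>D\<in>?A. (-1) ^ card D * ?t D) = (\<Prod>p\<in>P. 1 - 2 / real p) - (\<Sum>D\<in>?B. (-1) ^ card D * ?t D)"
    by simp
  moreover have "- (\<Sum>D\<in>?B. (-1) ^ card D * ?t D) \<le> (\<Sum>D\<in>?B. ?t D * (2 ^ card D / 2 ^ m))"
    unfolding sum_negf[symmetric]
  proof (rule sum_mono)
    fix D assume "D \<in> ?B"
    then have "(2::real) ^ m \<le> 2 ^ card D" by (intro power_increasing) auto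
    then have "1 \<le> (2::real) ^ card D / 2 ^ m" by simp
    from mult_left_mono[OF this t0[of D]] have "?t D \<le> ?t D * (2 ^ card D / 2 ^ m)" by simp
    moreover have "- ((-1) ^ card D * ?t D) \<le> ?t D" using t0[of D] by (cases "even (card D)") auto
    ultimately show "- ((-1) ^ card D * ?t D) \<le> ?t D * (2 ^ card D / 2 ^ m)" by linarith
  qed
  moreover have "(\<Sum>D\<in>?B. ?t D * (2 ^ card D / 2 ^ m)) \<le> (\<Sum>D\<in>Pow P. ?t D * (2 ^ card D / 2 ^ m))"
    using P(1) t0 by (intro sum_mono2) auto
  moreover have "(\<Sum>D\<in>Pow P. ?t D * (2 ^ card D / 2 ^ m)) \<le> exp (4 * (\<Sum>p\<in>P. 1 / real p)) / 2 ^ m"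
  proof -
    have "(\<Sum>D\<in>Pow P. ?t D * (2 ^ card D / 2 ^ m)) = (\<Sum>D\<in>Pow P. \<Prod>p\<in>D. 4 / real p) / 2 ^ m"
      by (simp add: sum_divide_distrib prod_dividef field_simps flip: power_mult_distrib)
    also have "(\<Sum>D\<in>Pow P. \<Prod>p\<in>D. 4 / real p) = (\<Prod>p\<in>P. 1 + 4 / real p)"
      using prod_add[OF P(1), of "\<lambda>p. 4 / real p" "\<lambda>_. 1"] by (simp add: add.commute)
    also have "\<dots> / 2 ^ m \<le> exp (\<Sum>p\<in>P. 4 / real p) / 2 ^ m"
      by (intro divide_right_mono prod_one_plus_le_exp) auto
    also have "(\<Sum>p\<in>P. 4 / real p) = 4 * (\<Sum>p\<in>P. 1 / real p)" by (simp add: sum_distrib_left)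
    finally show ?thesis .
  qed
  ultimately show ?thesis by linarith
qed

text \<open>
  Rankin's trick once more, now with the weight \<open>z\<close> to the power \<open>m - card D\<close>; the product
  \<open>(1 + 2 / z)\<^bsup>card P\<^esup>\<close> stays below \<open>exp 2\<close>.
\<close>

lemma brun_remainder:
  assumes P: "finite P" "card P \<le> z" and z: "z > 0"
  shows "(\<Sum>D | D \<subseteq> P \<and> card D \<le> m. 2 ^ card D) \<le> exp 2 * real z ^ m"
proof -
  have "(\<Sum>D | D \<subseteq> P \<and> card D \<le> m. (2::real) ^ card D) \<le> (\<Sum>D | D \<subseteq> P \<and> card D \<le> m. real z ^ m * (2 / real z) ^ card D)"
  proof (rule sum_mono)
    fix D assume "D \<in> {D. D \<subseteq> P \<and> card D \<le> m}"
    then have "real z ^ card D \<le> real z ^ m" using z by (intro power_increasing) auto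
    then show "2 ^ card D \<le> real z ^ m * (2 / real z) ^ card D" using z by (simp add: power_divide field_simps)
  qed
  also have "\<dots> \<le> (\<Sum>D\<in>Pow P. real z ^ m * (2 / real z) ^ card D)"
    using P(1) by (intro sum_mono2) auto
  also have "\<dots> = real z ^ m * (\<Sum>D\<in>Pow P. \<Prod>p\<in>D. 2 / real z)" by (simp add: sum_distrib_left)
  also have "(\<Sum>D\<in>Pow P. \<Prod>p\<in>D. 2 / real z) = (\<Prod>p\<in>P. 1 + 2 / real z)"
    using prod_add[OF P(1), of "\<lambda>p. 2 / real z" "\<lambda>_. 1"] by (simp add: add.commute)
  also have "\<dots> \<le> exp (\<Sum>p\<in>P. 2 / real z)" by (rule prod_one_plus_le_exp) auto
  also have "\<dots> \<le> exp 2" using P(2) z by (simp add: field_simps)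
  finally show ?thesis by (simp add: mult.commute mult_right_mono)
qed

text \<open>
  A finite form of Euler's product, by induction on the set of primes: split off the exact power of
  the new prime \<open>q\<close> from every \<open>n\<close> in \<open>A\<close> and sum the powers of \<open>1 / q\<close> as a geometric series.
\<close>

lemma sum_inverse_le_euler_product:
  assumes "finite P" "\<And>p. p \<in> P \<Longrightarrow> prime (p::nat)" "finite A" "\<And>n. n \<in> A \<Longrightarrow> n > 0 \<and> prime_factors n \<subseteq> P"
  shows "(\<Sum>n\<in>A. 1 / real n) \<le> (\<Prod>p\<in>P. 1 / (1 - 1 / real p))"
  using assms
proof (induction P arbitrary: A rule: finite_induct)
  case empty
  have "A \<subseteq> {1}"
  proof
    fix n assume "n \<in> A"
    with empty have "n > 0" "prime_factors n = {}" by auto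
    then show "n \<in> {1}" by (auto simp: prime_factorization_empty_iff)
  qed
  then have "(\<Sum>n\<in>A. 1 / real n) \<le> (\<Sum>n\<in>{1::nat}. 1 / real n)" by (intro sum_mono2) auto
  then show ?case by simp
next
  case (insert q P)
  have q: "prime q" "real q > 1" using insert prime_gt_1_nat by auto
  define g where "g n = (multiplicity q n, n div q ^ multiplicity q n)" for n
  define B where "B = (\<lambda>n. snd (g n)) ` A"
  define K where "K = Suc (Max (insert 0 ((\<lambda>n. fst (g n)) ` A)))"
  have dec: "n = q ^ fst (g n) * snd (g n)" for n
    unfolding g_def using multiplicity_dvd[of q n] by simp
  have inj: "inj_on g A" by (rule inj_onI, rule trans[OF dec], subst dec) simp
  have sub: "g ` A \<subseteq> {..<K} \<times> B"
  proof
    fix y assume "y \<in> g ` A"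
    then obtain n where n: "n \<in> A" "y = g n" by blast
    have "fst (g n) \<le> Max (insert 0 ((\<lambda>n. fst (g n)) ` A))" using n insert.prems by (intro Max_ge) auto
    then have "fst (g n) < K" unfolding K_def by (rule le_imp_less_Suc)
    moreover have "snd (g n) \<in> B" unfolding B_def using n(1) by (rule imageI)
    ultimately show "y \<in> {..<K} \<times> B" using n(2) by (simp add: mem_Times_iff)
  qed
  have B: "m > 0 \<and> prime_factors m \<subseteq> P" if m_in: "m \<in> B" for m
  proof -
    obtain n where n: "n \<in> A" "m = snd (g n)" using m_in unfolding B_def by blast
    have n0: "n > 0" "prime_factors n \<subseteq> insert q P" using insert.prems n by auto
    have nm: "n = q ^ fst (g n) * m" using dec[of n] unfolding n(2)[symmetric] .
    have m0: "m > 0" using nm n0 by (intro gr0I) simp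
    have "\<not> q dvd m"
      unfolding n(2) g_def snd_conv using n0 q by (intro multiplicity_decompose) auto
    moreover have "prime_factors m \<subseteq> prime_factors n"
    proof (rule dvd_prime_factors)
      show "m dvd n" by (subst nm) simp
    qed (use n0 in simp)
    ultimately show ?thesis using n0 m0 by (auto simp: in_prime_factors_iff)
  qed
  have finB: "finite B" unfolding B_def using insert.prems by simp
  have "(\<Sum>n\<in>A. 1 / real n) = (\<Sum>n\<in>A. (1 / real q) ^ fst (g n) * (1 / real (snd (g n))))"
  proof (rule sum.cong)
    fix n
    have "real n = real (q ^ fst (g n) * snd (g n))" using dec[of n] by (rule arg_cong)
    then have "real n = real q ^ fst (g n) * real (snd (g n))" by simp
    then show "1 / real n = (1 / real q) ^ fst (g n) * (1 / real (snd (g n)))" by (simp add: power_one_over)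
  qed simp
  also have "\<dots> = (\<Sum>y\<in>g ` A. (1 / real q) ^ fst y * (1 / real (snd y)))"
    using inj by (simp add: sum.reindex)
  also have "\<dots> \<le> (\<Sum>y\<in>{..<K} \<times> B. (1 / real q) ^ fst y * (1 / real (snd y)))"
    using sub finB by (intro sum_mono2) auto
  also have "\<dots> = (\<Sum>k<K. (1 / real q) ^ k) * (\<Sum>m\<in>B. 1 / real m)"
    by (simp add: sum_product sum.cartesian_product case_prod_beta)
  also have "\<dots> \<le> (1 / (1 - 1 / real q)) * (\<Prod>p\<in>P. 1 / (1 - 1 / real p))"
  proof (rule mult_mono)
    have "(\<Sum>k<K. (1 / real q) ^ k) \<le> (\<Sum>k. (1 / real q) ^ k)"
      using q by (intro sum_le_suminf summable_geometric) auto
    also have "\<dots> = 1 / (1 - 1 / real q)" using q by (intro suminf_geometric) auto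
    finally show "(\<Sum>k<K. (1 / real q) ^ k) \<le> 1 / (1 - 1 / real q)" .
    show "(\<Sum>m\<in>B. 1 / real m) \<le> (\<Prod>p\<in>P. 1 / (1 - 1 / real p))"
      using insert.prems B finB by (intro insert.IH) auto
  qed (use q in \<open>auto intro!: sum_nonneg\<close>)
  finally show ?case using insert by simp
qed

section \<open>Twin primes are negligible among the primes\<close>

definition odd_primes_le :: "nat \<Rightarrow> nat set" where
  "odd_primes_le z = {p. prime p \<and> odd p \<and> p \<le> z}"

lemma finite_odd_primes_le [simp]: "finite (odd_primes_le z)"
  unfolding odd_primes_le_def by (rule finite_subset[of _ "{..z}"]) auto

lemma odd_prime_ge_3: "prime (p::nat) \<Longrightarrow> odd p \<Longrightarrow> p \<ge> 3"
  using prime_ge_2_nat[of p] by (cases "p = 2") auto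

text \<open>
  Since \<open>1 - 2/p \<le> (1 - 1/p)\<^sup>2\<close>, it suffices to bound the product of \<open>1 - 1/p\<close>. By
  \<open>sum_inverse_le_euler_product\<close> its inverse, completed by the factor at \<open>2\<close>, dominates the harmonic
  sum up to \<open>z\<close>.
\<close>

lemma prod_odd_primes_le:
  assumes z: "z \<ge> 2"
  shows "(\<Prod>p\<in>odd_primes_le z. 1 - 2 / real p) \<le> 4 / ln (real z) ^ 2"
proof -
  let ?P = "odd_primes_le z"
  have p3: "real p \<ge> 3" if "p \<in> ?P" for p
    using odd_prime_ge_3[of p] that by (auto simp: odd_primes_le_def)
  let ?Q = "\<Prod>p\<in>?P. 1 - 1 / real p"
  have Q0: "?Q > 0" proof (rule prod_pos)
    fix p assume "p \<in> ?P"
    from p3[OF this] show "0 < 1 - 1 / real p" by simp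
  qed
  have lnz: "ln (real z) > 0" using z by simp
  have "ln (real z) \<le> harm z"
  proof -
    have "ln (real z) \<le> ln (real z + 1)" using z by simp
    then show ?thesis using ln_le_harm[of z] by linarith
  qed
  also have "harm z = (\<Sum>n\<in>{1..z}. 1 / real n)" by (simp add: harm_def inverse_eq_divide)
  also have "\<dots> \<le> (\<Prod>p\<in>insert 2 ?P. 1 / (1 - 1 / real p))"
  proof (rule sum_inverse_le_euler_product)
    fix n assume n: "n \<in> {1..z}"
    have "p \<in> insert 2 ?P" if "p \<in> prime_factors n" for p
    proof -
      have "prime p" "p dvd n" using that by auto
      moreover from this have "p \<le> z" using n dvd_imp_le[of p n] by auto
      ultimately show ?thesis using prime_odd_nat[of p] prime_ge_2_nat[of p]
        by (cases "p = 2") (auto simp: odd_primes_le_def)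
    qed
    then show "n > 0 \<and> prime_factors n \<subseteq> insert 2 ?P" using n by auto
  qed (auto simp: odd_primes_le_def)
  also have "\<dots> = 2 / ?Q"
    by (simp add: prod_dividef odd_primes_le_def)
  finally have Q: "?Q \<le> 2 / ln (real z)" using Q0 lnz by (simp add: field_simps)
  have "(\<Prod>p\<in>?P. 1 - 2 / real p) \<le> (\<Prod>p\<in>?P. (1 - 1 / real p) ^ 2)"
  proof (rule prod_mono)
    fix p assume "p \<in> ?P"
    then have "real p \<ge> 3" by (rule p3)
    then show "0 \<le> 1 - 2 / real p \<and> 1 - 2 / real p \<le> (1 - 1 / real p) ^ 2"
      by (simp add: power2_diff power_divide)
  qed
  also have "\<dots> = ?Q ^ 2" by (simp add: prod_power_distrib)
  also have "\<dots> \<le> (2 / ln (real z)) ^ 2" using Q Q0 by (intro power_mono) auto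
  finally show ?thesis by (simp add: power_divide)
qed

text \<open>
  Far from the true order \<open>ln (ln z)\<close>, but sufficient: up to \<open>exp (sqrt (ln z))\<close> compare with the
  harmonic sum, and beyond that point use \<open>ln p \<ge> sqrt (ln z)\<close> and \<open>sum_mangoldt_over_le\<close>.
\<close>

lemma sum_inverse_odd_primes_le:
  assumes z: "ln (real z) \<ge> 1"
  shows "(\<Sum>p\<in>odd_primes_le z. 1 / real p) \<le> 7 * sqrt (ln (real z))"
proof -
  let ?P = "odd_primes_le z"
  define L where "L = sqrt (ln (real z))"
  have L: "L \<ge> 1" "L ^ 2 = ln (real z)" using z by (auto simp: L_def)
  have z0: "z > 0" using z by (cases "z = 0") auto
  define w where "w = nat \<lfloor>exp L\<rfloor>"
  have w: "w \<ge> 1" "real w \<le> exp L" using L by (auto simp: w_def le_nat_floor intro: of_nat_floor)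
  let ?A = "{p\<in>?P. p \<le> w}" and ?B = "{p\<in>?P. p > w}"
  have "(\<Sum>p\<in>?P. 1 / real p) = (\<Sum>p\<in>?A. 1 / real p) + (\<Sum>p\<in>?B. 1 / real p)"
    by (subst sum.union_disjoint[symmetric]) (auto intro!: sum.cong)
  also have "(\<Sum>p\<in>?A. 1 / real p) \<le> 1 + L"
  proof -
    have "(\<Sum>p\<in>?A. 1 / real p) \<le> (\<Sum>n\<in>{1..w}. 1 / real n)"
      by (rule sum_mono2) (auto simp: odd_primes_le_def Suc_le_eq prime_gt_0_nat)
    also have "\<dots> = harm w" by (simp add: harm_def inverse_eq_divide)
    also have "\<dots> \<le> 1 + ln (real w)"
      using decseqD[OF decseq_harm_diff_ln, of 0 "w - 1"] w by (simp add: harm_expand)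
    also have "ln (real w) \<le> ln (exp L)" using w by (subst ln_le_cancel_iff) auto
    finally show ?thesis by simp
  qed
  also have "(\<Sum>p\<in>?B. 1 / real p) \<le> (L ^ 2 + 4) / L"
  proof -
    have "(\<Sum>p\<in>?B. 1 / real p) \<le> (\<Sum>p\<in>?B. mangoldt p / real p / L)"
    proof (rule sum_mono)
      fix p assume p: "p \<in> ?B"
      then have pr: "prime p" "p > w" by (auto simp: odd_primes_le_def)
      have "exp L < real p" using pr(2) unfolding w_def by linarith
      then have "ln (exp L) \<le> ln (real p)" by (intro ln_mono) auto
      then have "L \<le> mangoldt p" using pr by simp
      then have "1 \<le> mangoldt p / L" using L by simp
      from divide_right_mono[OF this, of "real p"] show "1 / real p \<le> mangoldt p / real p / L" by (simp add: field_simps)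
    qed
    also have "\<dots> = (\<Sum>p\<in>?B. mangoldt p / real p) / L" by (simp add: sum_divide_distrib)
    also have "(\<Sum>p\<in>?B. mangoldt p / real p) \<le> (\<Sum>d=1..z. mangoldt d / real d)"
      by (rule sum_mono2) (auto simp: odd_primes_le_def Suc_le_eq prime_gt_0_nat mangoldt_nonneg)
    also have "\<dots> \<le> L ^ 2 + 4" using sum_mangoldt_over_le[OF z0] L by simp
    finally show ?thesis using L by (simp add: divide_right_mono)
  qed
  also have "1 + L + (L ^ 2 + 4) / L \<le> 7 * L"
  proof -
    have "(L ^ 2 + 4) / L = L + 4 / L" using L by (simp add: field_simps power2_eq_square)
    moreover have "4 / L \<le> 4" using L by (simp add: field_simps)
    ultimately show ?thesis using L by linarith
  qed
  finally show ?thesis by (simp add: L_def)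
qed

definition twin_count :: "nat \<Rightarrow> nat" where
  "twin_count x = card {p. prime p \<and> prime (p + 2) \<and> p \<le> x}"

text \<open>
  A twin pair above \<open>z\<close> survives the sieve, as neither member has a prime factor up to \<open>z\<close>.
\<close>

lemma twin_count_le_sifted:
  "twin_count x \<le> z + card {n\<in>{1..x}. \<forall>p\<in>odd_primes_le z. \<not> p dvd n * (n + 2)}"
proof -
  let ?S = "{n\<in>{1..x}. \<forall>p\<in>odd_primes_le z. \<not> p dvd n * (n + 2)}"
  have "{p. prime p \<and> prime (p + 2) \<and> p \<le> x} \<subseteq> {1..z} \<union> ?S"
  proof
    fix q assume q: "q \<in> {p. prime p \<and> prime (p + 2) \<and> p \<le> x}"
    then have q': "prime q" "prime (q + 2)" "q \<le> x" by blast+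
    show "q \<in> {1..z} \<union> ?S"
    proof (cases "q \<le> z")
      case True
      then show ?thesis using q'(1) by (simp add: Suc_le_eq prime_gt_0_nat)
    next
      case False
      have "\<not> p dvd q * (q + 2)" if "p \<in> odd_primes_le z" for p
      proof
        assume d: "p dvd q * (q + 2)"
        have p: "prime p" "p \<le> z" using that by (auto simp: odd_primes_le_def)
        from d p(1) have "p dvd q \<or> p dvd q + 2" by (simp only: prime_dvd_mult_iff)
        then have "p = q \<or> p = q + 2" using p(1) q'(1,2) primes_dvd_imp_eq by blast
        then show False using p(2) False by linarith
      qed
      then show ?thesis using q' by (auto simp only: Un_iff mem_Collect_eq atLeastAtMost_iff dest: prime_ge_1_nat)
    qed
  qed
  then have "twin_count x \<le> card ({1..z} \<union> ?S)" unfolding twin_count_def by (intro card_mono) auto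
  also have "\<dots> \<le> z + card ?S" using card_Un_le[of "{1..z}" ?S] by simp
  finally show ?thesis .
qed

lemma twin_count_le_brun:
  assumes z: "ln (real z) \<ge> 1" and m: "even m"
  shows "real (twin_count x) \<le> real z + real x * (4 / ln (real z) ^ 2 + exp (28 * sqrt (ln (real z))) / 2 ^ m) + exp 2 * real z ^ m"
proof -
  let ?P = "odd_primes_le z"
  have z2: "z \<ge> 2" using z by (cases "z = 0"; cases "z = 1") auto
  have P: "\<And>p. p \<in> ?P \<Longrightarrow> prime p \<and> odd p" by (simp add: odd_primes_le_def)
  have card: "card ?P \<le> z"
  proof -
    have "?P \<subseteq> {1..z}" by (auto simp: odd_primes_le_def Suc_le_eq prime_gt_0_nat)
    from card_mono[OF _ this] show ?thesis by simp
  qed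
  have "real (twin_count x) \<le> real z + real (card {n\<in>{1..x}. \<forall>p\<in>?P. \<not> p dvd n * (n + 2)})"
    using twin_count_le_sifted[of x z] by linarith
  also have "real (card {n\<in>{1..x}. \<forall>p\<in>?P. \<not> p dvd n * (n + 2)}) \<le>
      (\<Sum>D | D \<subseteq> ?P \<and> card D \<le> m. (-1) ^ card D * (real x * (\<Prod>p\<in>D. 2 / real p)) + 2 ^ card D)"
    by (rule brun_sieve[OF finite_odd_primes_le P m])
  also have "\<dots> = real x * (\<Sum>D | D \<subseteq> ?P \<and> card D \<le> m. (-1) ^ card D * (\<Prod>p\<in>D. 2 / real p)) + (\<Sum>D | D \<subseteq> ?P \<and> card D \<le> m. 2 ^ card D)"
    by (simp only: sum.distrib sum_distrib_left mult.left_commute)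
  also have "\<dots> \<le> real x * ((\<Prod>p\<in>?P. 1 - 2 / real p) + exp (4 * (\<Sum>p\<in>?P. 1 / real p)) / 2 ^ m) + exp 2 * real z ^ m"
    using P z2 by (intro add_mono mult_left_mono brun_main_term brun_remainder card) (auto simp: prime_gt_0_nat)
  also have "\<dots> \<le> real x * (4 / ln (real z) ^ 2 + exp (28 * sqrt (ln (real z))) / 2 ^ m) + exp 2 * real z ^ m"
    using sum_inverse_odd_primes_le[OF z]
    by (intro add_mono mult_left_mono prod_odd_primes_le z2 divide_right_mono) auto
  finally show ?thesis by simp
qed

text \<open>
  Let \<open>L = ln x\<close>, and choose \<open>ln z\<close> near \<open>l x = L\<^bsup>11/20\<^esup>\<close> and \<open>m\<close> near \<open>2 L\<^bsup>3/10\<^esup>\<close>. The exponent \<open>11/20 > 1/2\<close> makes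
  the main term \<open>x / (ln z)\<^sup>2\<close> negligible against \<open>x / L\<close>. The truncation error is negligible because
  \<open>sqrt (ln z)\<close> has order \<open>L\<^bsup>11/40\<^esup>\<close> and \<open>11/40 < 3/10\<close>, so \<open>2\<^bsup>m\<^esup>\<close> wins. The remainder \<open>z\<^bsup>m\<^esup>\<close> is
  \<open>exp (O(L\<^bsup>17/20\<^esup>))\<close>, which is \<open>o(x / L)\<close>.
\<close>

lemma twin_count_negligible: "(\<lambda>x. real (twin_count x) * ln (real x) / real x) \<longlonglongrightarrow> 0"
proof (rule tendsto_sandwich)
  define l where "l x = ln (real x) powr (11/20)" for x
  define k where "k x = ln (real x) powr (3/10)" for x
  define F where "F x = exp (l x) + real x * (4 / (l x - 1) ^ 2 + exp (28 * sqrt (l x)) / 4 powr (k x - 1)) + exp 2 * exp (2 * l x * k x)" for x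
  show "(\<lambda>x::nat. 0::real) \<longlonglongrightarrow> 0" by simp
  show "\<forall>\<^sub>F x in sequentially. 0 \<le> real (twin_count x) * ln (real x) / real x"
    using eventually_ge_at_top[of 1] by eventually_elim auto
  show "(\<lambda>x. F x * ln (real x) / real x) \<longlonglongrightarrow> 0"
    unfolding F_def l_def k_def by real_asymp
  have "\<forall>\<^sub>F x in sequentially. l x \<ge> 2" "\<forall>\<^sub>F x in sequentially. k x \<ge> 0" "\<forall>\<^sub>F x::nat in sequentially. ln (real x) \<ge> 0"
    unfolding l_def k_def by real_asymp+
  then show "\<forall>\<^sub>F x in sequentially. real (twin_count x) * ln (real x) / real x \<le> F x * ln (real x) / real x"
  proof eventually_elim
    case (elim x)
    define z where "z = nat \<lfloor>exp (l x)\<rfloor>"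
    \<comment> \<open>The truncation level is \<open>2 j\<close>, as Bonferroni bounds from above at even levels.\<close>
    define j where "j = nat \<lfloor>k x\<rfloor>"
    have j: "real j \<le> k x" "k x - 1 \<le> real j" using elim by (auto simp: j_def of_nat_floor)
    have zle: "real z \<le> exp (l x)" by (simp add: z_def of_nat_floor)
    have "exp (l x - 1) \<le> exp (l x) - 1"
    proof -
      have e1: "exp (1::real) \<ge> 2" using exp_ge_add_one_self[of 1] by simp
      have "exp (l x - 1) \<ge> 1" using elim by simp
      moreover have "exp (l x) = exp 1 * exp (l x - 1)" by (simp flip: exp_add)
      moreover have "exp 1 * exp (l x - 1) \<ge> 2 * exp (l x - 1)" using e1 by (intro mult_right_mono) auto
      ultimately show ?thesis by linarith
    qed
    also have "\<dots> \<le> real z" unfolding z_def by linarith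
    finally have zge: "exp (l x - 1) \<le> real z" .
    have z0: "real z > 0" using zge exp_gt_zero[of "l x - 1"] by linarith
    have lnz: "l x - 1 \<le> ln (real z)" "ln (real z) \<le> l x"
    proof -
      show "l x - 1 \<le> ln (real z)" using zge z0 by (simp add: ln_ge_iff)
      have "ln (real z) \<le> ln (exp (l x))" using zle z0 by (subst ln_le_cancel_iff) auto
      then show "ln (real z) \<le> l x" by simp
    qed
    have "real (twin_count x) \<le> real z + real x * (4 / ln (real z) ^ 2 + exp (28 * sqrt (ln (real z))) / 2 ^ (2 * j)) + exp 2 * real z ^ (2 * j)"
      using lnz elim by (intro twin_count_le_brun) auto
    also have "\<dots> \<le> F x" unfolding F_def
    proof (intro add_mono mult_left_mono zle)
      show "4 / ln (real z) ^ 2 \<le> 4 / (l x - 1) ^ 2"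
        using lnz elim by (intro divide_left_mono power_mono mult_pos_pos) auto
      have "4 powr (k x - 1) \<le> 4 powr real j" using j by (intro powr_mono) auto
      also have "\<dots> = 2 ^ (2 * j)" by (simp add: powr_realpow power_mult)
      finally show "exp (28 * sqrt (ln (real z))) / 2 ^ (2 * j) \<le> exp (28 * sqrt (l x)) / 4 powr (k x - 1)"
        using lnz by (intro frac_le) auto
      have "real z ^ (2 * j) \<le> exp (l x) ^ (2 * j)" using zle by (intro power_mono) auto
      also have "\<dots> = exp (2 * l x * real j)" by (simp flip: exp_of_nat_mult add: mult_ac)
      also have "\<dots> \<le> exp (2 * l x * k x)" using j elim by (simp add: mult_left_mono)
      finally show "real z ^ (2 * j) \<le> exp (2 * l x * k x)" .
    qed auto
    finally show ?case using elim by (intro divide_right_mono mult_right_mono) auto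
  qed
qed

section \<open>The average length of a sequence of composites\<close>

lemma consecutive_primes_unique:
  assumes "consecutive_primes p q" "consecutive_primes p q'"
  shows "q = q'"
  using assms unfolding consecutive_primes_def by (metis linorder_neqE_nat)

lemma next_prime_exists:
  assumes "prime p"
  shows "\<exists>q. consecutive_primes p q"
proof -
  define q where "q = (LEAST q. prime q \<and> q > p)"
  have "\<exists>q. prime q \<and> q > p" using bigger_prime[of p] by blast
  then have "prime q \<and> q > p" unfolding q_def by (rule LeastI_ex)
  moreover have "\<not> prime r" if "p < r" "r < q" for r
    using not_less_Least[of r "\<lambda>q. prime q \<and> q > p"] that unfolding q_def by blast
  ultimately show ?thesis using assms by (auto simp: consecutive_primes_def)
qed

lemma set_composite_seq: "set (composite_seq x p q) = {m. p < m \<and> m < q \<and> m \<le> x \<and> composite m}"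
  by (auto simp: composite_seq_def)

lemma finite_twin_primes [simp]: "finite {p::nat. prime p \<and> prime (p + 2) \<and> p \<le> x}"
  by (rule finite_subset[of _ "{..x}"]) auto

lemma short_gap:
  assumes "consecutive_primes p q" "q - p \<le> 2"
  shows "p = 2 \<or> prime (p + 2) \<and> q = p + 2"
proof -
  have pq: "prime p" "prime q" "p < q" using assms by (auto simp: consecutive_primes_def)
  have p2: "p \<ge> 2" using pq(1) by (rule prime_ge_2_nat)
  consider "q = p + 1" | "q = p + 2" using assms(2) pq(3) by linarith
  then show ?thesis
  proof cases
    case 1
    show ?thesis
    proof (rule ccontr)
      assume "\<not> ?thesis"
      then have "p > 2" "q > 2" using p2 1 by auto
      then have "odd p" "odd q" using pq prime_odd_nat by auto
      then show False using 1 by simp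
    qed
  qed (use pq in auto)
qed

lemma composite_seqs_finite_card_le: "finite (composite_seqs x) \<and> card (composite_seqs x) \<le> prime_count x"
proof -
  define nxt where "nxt p = (SOME q. consecutive_primes p q)" for p
  have nxt: "q = nxt p" if "consecutive_primes p q" for p q
    unfolding nxt_def by (rule consecutive_primes_unique[OF that someI[of "consecutive_primes p", OF that]])
  have sub: "composite_seqs x \<subseteq> (\<lambda>p. composite_seq x p (nxt p)) ` {p. prime p \<and> p \<le> x}"
  proof
    fix s assume "s \<in> composite_seqs x"
    then obtain p q where pq: "s = composite_seq x p q" "consecutive_primes p q" "p < x"
      unfolding composite_seqs_def by blast
    then have "s = composite_seq x p (nxt p)" "prime p" "p \<le> x"
      using nxt[OF pq(2)] by (simp_all add: consecutive_primes_def)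
    then show "s \<in> (\<lambda>p. composite_seq x p (nxt p)) ` {p. prime p \<and> p \<le> x}" by blast
  qed
  then show ?thesis unfolding prime_count_def
    using finite_subset[OF sub] surj_card_le[OF _ sub] by simp
qed

text \<open>
  A sequence begins with \<open>p + 1\<close>, so different primes give different sequences. The prime \<open>x\<close> itself,
  if \<open>x\<close> is prime, has to be excluded along with \<open>2\<close> and the twin primes, which costs the summand \<open>2\<close>.
\<close>

lemma card_composite_seqs_ge: "prime_count x \<le> card (composite_seqs x) + twin_count x + 2"
proof -
  define nxt where "nxt p = (SOME q. consecutive_primes p q)" for p
  have nxt: "consecutive_primes p (nxt p)" if "prime p" for p
    unfolding nxt_def using next_prime_exists[OF that] by (rule someI_ex)
  let ?G = "{p. prime p \<and> p < x \<and> nxt p - p > 2}"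
  note mem = set_composite_seq
  have first: "p + 1 \<in> set (composite_seq x p (nxt p))" if "p \<in> ?G" for p
  proof -
    have "p > 1" "\<not> prime (p + 1)"
      using that nxt[of p] prime_gt_1_nat by (auto simp: consecutive_primes_def)
    then show ?thesis using that by (auto simp: mem composite_def)
  qed
  have inj: "inj_on (\<lambda>p. composite_seq x p (nxt p)) ?G"
  proof (rule inj_onI)
    fix p p' assume p: "p \<in> ?G" "p' \<in> ?G" "composite_seq x p (nxt p) = composite_seq x p' (nxt p')"
    have "p' + 1 \<in> set (composite_seq x p (nxt p))" "p + 1 \<in> set (composite_seq x p' (nxt p'))"
      using first[OF p(1)] first[OF p(2)] p(3) by simp_all
    then show "p = p'" by (auto simp: mem)
  qed
  have img: "(\<lambda>p. composite_seq x p (nxt p)) ` ?G \<subseteq> composite_seqs x"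
    using nxt by (auto simp: composite_seqs_def)
  have "card ?G \<le> card (composite_seqs x)"
    using card_inj_on_le[OF inj img] composite_seqs_finite_card_le by blast
  moreover have "{p. prime p \<and> p \<le> x} \<subseteq> ?G \<union> {p. prime p \<and> prime (p + 2) \<and> p \<le> x} \<union> {2, x}"
  proof
    fix p assume p: "p \<in> {p. prime p \<and> p \<le> x}"
    then show "p \<in> ?G \<union> {p. prime p \<and> prime (p + 2) \<and> p \<le> x} \<union> {2, x}"
      using short_gap[OF nxt[of p]] by (cases "nxt p - p > 2") auto
  qed
  then have "prime_count x \<le> card (?G \<union> {p. prime p \<and> prime (p + 2) \<and> p \<le> x} \<union> {2, x})"
    unfolding prime_count_def by (intro card_mono) auto
  moreover have "card (?G \<union> {p. prime p \<and> prime (p + 2) \<and> p \<le> x} \<union> {2, x})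
      \<le> card ?G + twin_count x + card {2, x}"
    unfolding twin_count_def by (rule order_trans[OF card_Un_le add_right_mono[OF card_Un_le]])
  moreover have "card {2, x} \<le> 2" by (simp add: card_insert_if)
  ultimately show ?thesis by linarith
qed

text \<open>
  A composite \<open>m\<close> lies between the largest prime \<open>p\<close> below it and the successor \<open>q\<close> of \<open>p\<close>. It is missing from
  the union only if \<open>q - p \<le> 2\<close>, and then \<open>m = p + 1\<close> with \<open>p\<close> and \<open>p + 2\<close> twin primes. The numbers up to
  \<open>x\<close> are thus exhausted by the union, the primes, these exceptions, and \<open>1\<close>.
\<close>

lemma union_composite_seqs:
  "card (\<Union>s\<in>composite_seqs x. set s) \<le> x"
  "x \<le> card (\<Union>s\<in>composite_seqs x. set s) + prime_count x + twin_count x + 2"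
proof -
  let ?U = "\<Union>s\<in>composite_seqs x. set s"
  have sub: "?U \<subseteq> {1..x}"
  proof
    fix m assume "m \<in> ?U"
    then obtain p q where "m \<in> set (composite_seq x p q)" unfolding composite_seqs_def by blast
    then show "m \<in> {1..x}" by (simp add: set_composite_seq)
  qed
  then have "card ?U \<le> card {1..x}" by (rule card_mono[rotated]) simp
  then show "card ?U \<le> x" by simp
  have finU: "finite ?U" using sub by (rule finite_subset) simp
  let ?T = "{p. prime p \<and> prime (p + 2) \<and> p \<le> x}"
  have "{1..x} \<subseteq> ?U \<union> {p. prime p \<and> p \<le> x} \<union> Suc ` ?T \<union> {1}"
  proof
    fix m assume m: "m \<in> {1..x}"
    show "m \<in> ?U \<union> {p. prime p \<and> p \<le> x} \<union> Suc ` ?T \<union> {1}"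
    proof (cases "composite m")
      case True
      have m2: "m > 2" "\<not> prime m" 
      proof -
        have "m \<noteq> 2" using \<open>composite m\<close> two_is_prime_nat unfolding composite_def by metis
        then show "m > 2" "\<not> prime m" using \<open>composite m\<close> unfolding composite_def by linarith+
      qed
      let ?P = "{p. prime p \<and> p < m}"
      have finP: "finite ?P" by (rule finite_subset[of _ "{..m}"]) auto
      have neP: "?P \<noteq> {}" using m2 two_is_prime_nat by blast
      define p where "p = Max ?P"
      have p: "prime p" "p < m" using Max_in[OF finP neP] by (auto simp: p_def)
      have pmax: "r \<le> p" if "prime r" "r < m" for r using Max_ge[OF finP, of r] that by (simp add: p_def)
      obtain q where q: "consecutive_primes p q" using next_prime_exists[OF p(1)] by blast
      then have q': "prime q" "p < q" by (auto simp: consecutive_primes_def)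
      have "m \<le> q" using pmax[of q] q' by linarith
      then have mq: "m < q" using m2(2) q'(1) by (cases "m = q") auto
      show ?thesis
      proof (cases "q - p > 2")
        case True
        then have "composite_seq x p q \<in> composite_seqs x"
          unfolding composite_seqs_def mem_Collect_eq using q p m by (intro exI[of _ p] exI[of _ q]) simp
        moreover have "m \<in> set (composite_seq x p q)"
          using \<open>composite m\<close> p mq m by (simp add: set_composite_seq)
        ultimately show ?thesis by blast
      next
        case False
        then have "p = 2 \<or> prime (p + 2) \<and> q = p + 2" using short_gap[OF q] by simp
        moreover have "p \<noteq> 2"
        proof
          assume "p = 2"
          then have "m = 3" using False mq p(2) m2 q' by linarith
          then show False using m2(2) by (simp add: prime_nat_numeral_eq)
        qed
        ultimately have "prime (p + 2)" "m = Suc p" using mq p(2) by auto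
        then have "m \<in> Suc ` ?T" using p m by (intro image_eqI[of _ _ p]) simp_all
        then show ?thesis by blast
      qed
    next
      case False
      then show ?thesis using m by (cases "m = 1") (auto simp: composite_def)
    qed
  qed
  then have "card {1..x} \<le> card (?U \<union> {p. prime p \<and> p \<le> x} \<union> Suc ` ?T \<union> {1})"
    using finU by (intro card_mono) auto
  also have "\<dots> \<le> card ?U + prime_count x + card (Suc ` ?T) + card {1::nat}"
    unfolding prime_count_def
    by (rule order_trans[OF card_Un_le add_right_mono[OF order_trans[OF card_Un_le add_right_mono[OF card_Un_le]]]])
  also have "card (Suc ` ?T) \<le> twin_count x" unfolding twin_count_def by (rule card_image_le) simp
  finally show "x \<le> card ?U + prime_count x + twin_count x + 2" by simp
qed

text \<open>
  Divide the number of composites by \<open>x\<close> and the number of sequences by \<open>x / ln x\<close>. Both quotients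
  tend to \<open>1\<close>: the first because primes have density zero, the second because twin primes are
  negligible among the primes.
\<close>

lemma avg_composites_asymptotic: "(\<lambda>x. avg_composites x / ln (real x)) \<longlonglongrightarrow> 1"
proof -
  let ?num = "\<lambda>x. real (card (\<Union>s\<in>composite_seqs x. set s)) / real x"
  let ?den = "\<lambda>x. real (card (composite_seqs x)) * ln (real x) / real x"
  have small: "(\<lambda>x. 2 * ln (real x) / real x) \<longlonglongrightarrow> 0" "(\<lambda>x. 2 / real x) \<longlonglongrightarrow> 0" "(\<lambda>x. 1 / ln (real x)) \<longlonglongrightarrow> 0"
    by real_asymp+
  have den: "?den \<longlonglongrightarrow> 1"
  proof (rule tendsto_sandwich)
    let ?lo = "\<lambda>x. real (prime_count x) * ln (real x) / real x - real (twin_count x) * ln (real x) / real x - 2 * ln (real x) / real x"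
    show "\<forall>\<^sub>F x in sequentially. ?lo x \<le> ?den x"
      using eventually_ge_at_top[of 1]
    proof eventually_elim
      case (elim x)
      have "real (prime_count x) - real (twin_count x) - 2 \<le> real (card (composite_seqs x))"
        using card_composite_seqs_ge[of x] by linarith
      then have "(real (prime_count x) - real (twin_count x) - 2) * ln (real x) / real x \<le> ?den x"
        using elim by (intro divide_right_mono mult_right_mono) auto
      then show ?case by (simp add: diff_divide_distrib left_diff_distrib)
    qed
    show "\<forall>\<^sub>F x in sequentially. ?den x \<le> real (prime_count x) * ln (real x) / real x"
      using eventually_ge_at_top[of 1]
      by eventually_elim (intro divide_right_mono mult_right_mono, use composite_seqs_finite_card_le in auto)
    show "(\<lambda>x. real (prime_count x) * ln (real x) / real x) \<longlonglongrightarrow> 1" by (rule prime_number_theorem)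
    show "?lo \<longlonglongrightarrow> 1"
      using tendsto_diff[OF tendsto_diff[OF prime_number_theorem twin_count_negligible] small(1)] by simp
  qed
  have num: "?num \<longlonglongrightarrow> 1"
  proof (rule tendsto_sandwich)
    let ?lo = "\<lambda>x. 1 - (real (prime_count x) * ln (real x) / real x) * (1 / ln (real x)) - (real (twin_count x) * ln (real x) / real x) * (1 / ln (real x)) - 2 / real x"
    show "\<forall>\<^sub>F x in sequentially. ?lo x \<le> ?num x"
      using eventually_gt_at_top[of 1]
    proof eventually_elim
      case (elim x)
      have "real x - real (prime_count x) - real (twin_count x) - 2 \<le> real (card (\<Union>s\<in>composite_seqs x. set s))"
        using union_composite_seqs(2)[of x] by linarith
      then have "(real x - real (prime_count x) - real (twin_count x) - 2) / real x \<le> ?num x"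
        by (intro divide_right_mono) auto
      then show ?case using elim by (simp add: diff_divide_distrib)
    qed
    show "\<forall>\<^sub>F x in sequentially. ?num x \<le> 1"
      using eventually_gt_at_top[of 0] by eventually_elim (use union_composite_seqs(1) in auto)
    show "?lo \<longlonglongrightarrow> 1"
      using tendsto_diff[OF tendsto_diff[OF tendsto_diff[OF tendsto_const[of 1] tendsto_mult[OF prime_number_theorem small(3)]]
        tendsto_mult[OF twin_count_negligible small(3)]] small(2)] by simp
  qed simp
  have "(\<lambda>x. ?num x / ?den x) \<longlonglongrightarrow> 1" using tendsto_divide[OF num den] by simp
  moreover have "\<forall>\<^sub>F x in sequentially. ?num x / ?den x = avg_composites x / ln (real x)"
    using eventually_gt_at_top[of 1] by eventually_elim (simp add: avg_composites_def)
  ultimately show ?thesis by (rule Lim_transform_eventually)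
qed

theorem theorem3p4:
  "((\<lambda>x::nat. avg_composites x / ln (real x)) \<longlongrightarrow> 1)
     (inf at_top (principal {x. composite x \<and> odd x}))"
  by (rule tendsto_mono[OF inf_le1 avg_composites_asymptotic])

end
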